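(* Let $G(n)$ denote the number of graceful $n$-permutations. Then $G(n)=\Omega(2.37^n)$ as $n\to\infty$; that is, there exist a real constant $c>0$ and an integer $n_0$ such that $G(n)\ge c\cdot 2.37^n$ for all integers $n\ge n_0$.
   Context: A permutation $[\sigma(0),\ldots,\sigma(n-1)]$ of the set $\{0,1,\ldots,n-1\}$ is called a graceful $n$-permutation if $$\{|\sigma(1)-\sigma(0)|,|\sigma(2)-\sigma(1)|,\ldots,|\sigma(n-1)-\sigma(n-2)|\}=\{1,\ldots,n-1\}.$$ A permutation and its reversal are counted as two permutations (when they differ). *)

theory Defs
  imports Complex_Main "HOL-Combinatorics.Permutations"
begin

definition graceful_permutation :: "nat \<Rightarrow> (nat \<Rightarrow> nat) \<Rightarrow> bool" where
  "graceful_permutation n \<sigma> \<longleftrightarrow>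
     \<sigma> permutes {0..<n} \<and>
     {\<bar>int (\<sigma> (Suc i)) - int (\<sigma> i)\<bar> | i. Suc i < n} = {1..int n - 1}"

(* The set counted is finite for every n, since "permutes" requires \<sigma> to be the
   identity outside {0..<n}. *)
definition num_graceful :: "nat \<Rightarrow> nat" where
  "num_graceful n = card {\<sigma>. graceful_permutation n \<sigma>}"

end

theory Submission
  imports Defs
begin

text \<open>
  Place the differences n-1, n-2, ... one after the other. An edge with a large difference joins a
  label close to 0 to a label close to n-1, so the partial configurations are described by which
  labels near the two ends of the interval still need edges and how the path fragments built so
  far pair up the fragment ends. Restricted to permutations that start with the label 6, only 1177
  such boundary states (up to reflection) can occur, whatever n is, and the transitions between them
  form a matrix M of spectral radius about 2.463. A positive integer vector w with
  100 M w \<ge> 237 w (a rounded Perron vector) then forces the number of completions to grow at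
  least like 2.37^n, as soon as every state is known to have a completion for all large
  n. The latter follows from one explicit permutation of 14 labels, closed walks of the coprime
  lengths 13 and 14 at the initial state, and a walk from every state back to the initial one.
\<close>

section \<open>Completions of a partial path\<close>

text \<open>Splitting the completions by the edge that carries the largest remaining difference
  gives disjoint classes, and the completions of each joined configuration inject into their class.
  The result is a linear system of inequalities, so an integer vector with the componentwise
  inequality is enough and plain induction replaces eigenvalue theory. That induction needs a base
  at one common number of remaining differences for all states; this is why closed walks of coprime
  lengths are wanted in addition to walks back to the initial state. The obstacle is that a boundary
  state is meaningful only while its two ends do not meet. Transitions are therefore used only down
  to 13 remaining differences, and everything below rests on the one explicit path. The distance
  between 2.463 and 2.37 absorbs the rounding of the vector, so that entries of two digits
  suffice.\<close>

definition steps :: "'a list \<Rightarrow> ('a \<times> 'a) set" where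
  "steps p = set (zip p (tl p))"

lemma steps_Nil [simp]: "steps [] = {}" and steps_single [simp]: "steps [a] = {}"
  and steps_Cons_Cons [simp]: "steps (a # b # p) = insert (a, b) (steps (b # p))"
  by (auto simp: steps_def)

lemma steps_append: "steps (p @ a # q) = steps (p @ [a]) \<union> steps (a # q)"
  by (induction p rule: induct_list012) auto

lemma steps_subset: "(a, b) \<in> steps p \<Longrightarrow> a \<in> set p \<and> b \<in> set p"
  unfolding steps_def by (metis in_set_zipE list.set_sel(2) list.sel(2))

lemma steps_split: "(a, b) \<in> steps p \<Longrightarrow> \<exists>p1 p2. p = p1 @ a # b # p2"
proof (induction p rule: induct_list012)
  case (3 x y zs)
  show ?case
  proof (cases "(a, b) = (x, y)")
    case True then show ?thesis by (intro exI[of _ "[]"] exI[of _ zs]) auto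
  next
    case False
    with 3 obtain p1 p2 where "y # zs = p1 @ a # b # p2" by auto
    then show ?thesis by (intro exI[of _ "x # p1"] exI[of _ p2]) simp
  qed
qed auto

lemma steps_neq: "distinct p \<Longrightarrow> (a, b) \<in> steps p \<Longrightarrow> a \<noteq> b"
  by (auto dest!: steps_split)

lemma steps_map: "steps (map f p) = map_prod f f ` steps p"
  by (induction p rule: induct_list012) auto

lemma steps_nth: "steps p = {(p ! i, p ! Suc i) | i. Suc i < length p}"
  by (auto simp: steps_def set_zip nth_tl)

text \<open>
  A partial path is encoded by a map m on labels: saturated labels are mapped to None, every other
  label to the opposite end of its fragment (itself if it is untouched). The label -1 stands for
  the fixed start of the whole path. A completion lists -1 and then the unsaturated labels in path
  order, so that every fragment is contracted to a single step; the steps that are not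
  fragments are the edges still to be placed.
\<close>

definition real_steps :: "(int \<Rightarrow> int option) \<Rightarrow> int list \<Rightarrow> (int \<times> int) set" where
  "real_steps m p = {(a, b) \<in> steps p. m a \<noteq> Some b \<and> m b \<noteq> Some a}"

definition gap :: "int \<times> int \<Rightarrow> nat" where
  "gap e = nat \<bar>fst e - snd e\<bar>"

definition completions :: "(int \<Rightarrow> int option) \<Rightarrow> nat \<Rightarrow> int list set" where
  "completions m d = {p. distinct p \<and> p \<noteq> [] \<and> hd p = -1 \<and> set p = insert (-1) (dom m) \<and>
     (\<forall>x y. m x = Some y \<longrightarrow> x \<noteq> y \<longrightarrow> (x, y) \<in> steps p \<or> (y, x) \<in> steps p) \<and>
     bij_betw gap (real_steps m p) {1..d}}"

text \<open>The pairing is one-sided at -1: a label whose fragment begins at the start points to -1,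
  but -1 has no entry. This keeps -1 out of \<open>dom m\<close> and hence away from the new
  edges.\<close>

definition mates :: "(int \<Rightarrow> int option) \<Rightarrow> bool" where
  "mates m \<longleftrightarrow> m (-1) = None \<and> (\<forall>x y. m x = Some y \<longrightarrow> y = -1 \<or> m y = Some x)"

text \<open>The map after adding the edge x-y, where u and v are the other ends of the fragments of x and y.\<close>

definition join :: "(int \<Rightarrow> int option) \<Rightarrow> int \<Rightarrow> int \<Rightarrow> int \<Rightarrow> int \<Rightarrow> int \<Rightarrow> int option" where
  "join m x u y v = (m(x := None, y := None, u := Some v, v := Some u))(-1 := None)"

lemma finite_completions: "finite (completions m d)"
proof (cases "finite (dom m)")
  case True
  then have "finite {xs. set xs \<subseteq> insert (-1) (dom m) \<and> distinct xs}"
    by (intro finite_subset_distinct) auto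
  then show ?thesis by (rule finite_subset[rotated]) (auto simp: completions_def)
next
  case False
  then have "completions m d = {}" 
    by (auto simp: completions_def) (metis List.finite_set finite_insert)
  then show ?thesis by simp
qed

text \<open>\<open>u \<noteq> y\<close> forbids joining the two ends of one fragment, which would
  close a cycle. By \<open>mates\<close>, \<open>u = v\<close> could happen only at -1, with both
  fragments hanging on the start.\<close>

locale joining =
  fixes m :: "int \<Rightarrow> int option" and x u y v :: int and d :: nat
  assumes mates: "mates m" and x: "m x = Some u" and y: "m y = Some v"
    and ne: "u \<noteq> y" "u \<noteq> v" and gap: "gap (x, y) = Suc d"
begin

abbreviation m' where "m' \<equiv> join m x u y v"

lemma xy: "x \<noteq> y" using gap by (auto simp: gap_def)

lemma sym: "m a = Some b \<Longrightarrow> b = -1 \<or> m b = Some a" using mates by (auto simp: mates_def)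

lemma neg [simp]: "m (-1) = None" "x \<noteq> -1" "y \<noteq> -1"
  using mates x y by (auto simp: mates_def)

lemma vx: "v \<noteq> x" 
  using sym[OF y] x ne by auto

lemma mu: "u = -1 \<or> m u = Some x" and mv: "v = -1 \<or> m v = Some y"
  using sym x y by blast+

lemma swap: "joining m y v x u d"
  using mates x y ne vx gap by unfold_locales (auto simp: gap_def abs_minus_commute)

lemma join_swap: "join m y v x u = m'"
  using ne xy by (auto simp: join_def fun_eq_iff)

lemma mates_join: "mates m'"
proof -
  have "b = -1 \<or> m' b = Some a" if "m' a = Some b" for a b
    using that sym[of a b] mu mv x y ne vx xy
    by (auto simp: join_def split: if_splits)
  then show ?thesis by (simp add: mates_def) (simp add: join_def)
qed

text \<open>An untouched label (\<open>u = x\<close>) becomes a fragment end and stays unsaturated;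
  only the end of a proper fragment leaves the domain.\<close>

lemma dom_join: "insert (-1) (dom m') = insert (-1) (dom m) - (if u = x then {} else {x}) - (if v = y then {} else {y})"
  using mu mv x y xy ne vx by (auto simp: join_def dom_def split: if_splits)

text \<open>The fragment u-v of the new configuration is the old u-x, the edge x-y and the old y-v.\<close>

lemma extend_aux:
  assumes q: "q \<in> completions m' d" and uv: "(u, v) \<in> steps q"
  shows "\<exists>p \<in> completions m (Suc d). filter (\<lambda>z. z \<in> insert (-1) (dom m')) p = q \<and> (x, y) \<in> steps p"
proof -
  obtain A B where q_eq: "q = A @ u # v # B" using steps_split[OF uv] by blast
  \<comment> \<open>Each old fragment appears contracted: one entry if its label is untouched, two
    otherwise.\<close>
  define X where "X = (if u = x then [x] else [u, x])"
  define Y where "Y = (if v = y then [y] else [y, v])"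
  define p where "p = A @ X @ Y @ B"
  have dq: "distinct q" and hq: "hd q = -1" and sq: "set q = insert (-1) (dom m')"
    and adj: "\<And>a b. m' a = Some b \<Longrightarrow> a \<noteq> b \<Longrightarrow> (a, b) \<in> steps q \<or> (b, a) \<in> steps q"
    and bij: "bij_betw gap (real_steps m' q) {1..d}"
    using q by (auto simp: completions_def)
  have xq: "u = x \<or> x \<notin> set q" and yq: "v = y \<or> y \<notin> set q"
    using sq dom_join by auto
  have sp: "set p = insert (-1) (dom m)"
  proof -
    have "set p = set q \<union> {x, y}" by (auto simp: p_def q_eq X_def Y_def)
    also have "\<dots> = insert (-1) (dom m)" unfolding sq dom_join using x y by auto
    finally show ?thesis .
  qed
  have dp: "distinct p"
    using dq xq yq xy ne vx unfolding p_def q_eq X_def Y_def by (auto split: if_splits)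
  have fp: "filter (\<lambda>z. z \<in> insert (-1) (dom m')) p = q"
  proof -
    have f: "filter (\<lambda>z. z \<in> set q) p = q"
    proof -
      have "filter (\<lambda>z. z \<in> set q) X = [u]" using xq by (auto simp: X_def q_eq)
      moreover have "filter (\<lambda>z. z \<in> set q) Y = [v]" using yq by (auto simp: Y_def q_eq)
      moreover have "filter (\<lambda>z. z \<in> set q) A = A" "filter (\<lambda>z. z \<in> set q) B = B"
        by (auto simp: q_eq filter_id_conv)
      ultimately show ?thesis unfolding p_def by (simp add: q_eq)
    qed
    then show ?thesis unfolding sq .
  qed
  have hp: "p \<noteq> []" "hd p = -1"
    using hq x by (auto simp: p_def q_eq X_def Y_def hd_append split: if_splits)
  define R where "R = steps (A @ [u]) \<union> steps (v # B)"
  have Rq: "steps q = insert (u, v) R"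
    using steps_append[of A u "v # B"] by (auto simp: q_eq R_def)
  have Rp: "steps p = R \<union> {(x, y)} \<union> (if u = x then {} else {(u, x)}) \<union> (if v = y then {} else {(y, v)})"
  proof -
    have "steps p = steps (A @ [hd X]) \<union> steps (X @ Y @ B)"
      using steps_append[of A "hd X" "tl X @ Y @ B"] by (auto simp: p_def X_def)
    moreover have "steps (X @ Y @ B) = (if u = x then {} else {(u, x)}) \<union> steps (x # Y @ B)"
      by (auto simp: X_def)
    moreover have "steps (x # Y @ B) = {(x, y)} \<union> (if v = y then {} else {(y, v)}) \<union> steps (v # B)"
      by (auto simp: Y_def)
    moreover have "hd X = u" by (simp add: X_def)
    ultimately show ?thesis by (auto simp: R_def)
  qed
  have Rset: "a \<noteq> u \<and> b \<noteq> v \<and> a \<noteq> b \<and> (a, b) \<noteq> (v, u) \<and> a \<in> set q \<and> b \<in> set q" if "(a, b) \<in> R" for a b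
  proof -
    from that have "(a, b) \<in> steps (A @ [u]) \<or> (a, b) \<in> steps (v # B)" by (auto simp: R_def)
    then show ?thesis
    proof
      assume ab: "(a, b) \<in> steps (A @ [u])"
      obtain C D where CD: "A @ [u] = C @ a # b # D" using steps_split[OF ab] by blast
      then have "a \<in> set A" by (cases D rule: rev_cases) auto
      moreover have "b \<in> set (A @ [u])" by (simp add: CD)
      moreover have "distinct (A @ [u])" using dq by (simp add: q_eq)
      then have "a \<noteq> b" unfolding CD by simp
      ultimately show ?thesis using dq by (auto simp: q_eq)
    next
      assume ab: "(a, b) \<in> steps (v # B)"
      obtain C D where CD: "v # B = C @ a # b # D" using steps_split[OF ab] by blast
      then have "b \<in> set B" by (cases C) auto
      moreover have "a \<in> set (v # B)" by (simp add: CD)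
      moreover have "distinct (v # B)" using dq by (simp add: q_eq)
      then have "a \<noteq> b" unfolding CD by simp
      ultimately show ?thesis using dq by (auto simp: q_eq)
    qed
  qed
  have keep: "m a = m' a" if "a \<notin> {x, y, u, v}" for a
    using that by (auto simp: join_def)
  \<comment> \<open>The maps differ at most at x, y, u, v. A step of \<open>R\<close> never leaves
    u, never enters v and is not (v, u), so at these labels neither map names its partner. Hence
    both maps regard the same steps of \<open>R\<close> as fragments.\<close>
  have R_iff: "(m a = Some b \<longleftrightarrow> m' a = Some b) \<and> (m b = Some a \<longleftrightarrow> m' b = Some a)" if "(a, b) \<in> R" for a b
  proof -
    note ab = Rset[OF that]
    have ends: "m' u = None \<or> m' u = Some v" "m' v = None \<or> m' v = Some u"
      using ne by (auto simp: join_def)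
    have mu': "m u = None \<or> m u = Some x" "m v = None \<or> m v = Some y"
      using mu mv by auto
    have "m a = Some b \<longleftrightarrow> m' a = Some b"
    proof (cases "a = v")
      case True
      have "b \<noteq> u" using ab True by auto
      moreover have "b \<noteq> y" using ab yq True by auto
      ultimately show ?thesis using True ends mu' by auto
    next
      case False
      have "a \<noteq> x" "a \<noteq> y" using ab xq yq False by auto
      then show ?thesis using keep[of a] False ab by auto
    qed
    moreover have "m b = Some a \<longleftrightarrow> m' b = Some a"
    proof (cases "b = u")
      case True
      have "a \<noteq> v" using ab True by auto
      moreover have "a \<noteq> x" using ab xq True by auto
      ultimately show ?thesis using True ends mu' by auto
    next
      case False
      have "b \<noteq> x" "b \<noteq> y" using ab xq yq False by auto
      then show ?thesis using keep[of b] False ab by auto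
    qed
    ultimately show ?thesis by simp
  qed
  have uvm: "m' u = Some v \<or> m' v = Some u"
    using ne by (auto simp: join_def)
  have real_q: "real_steps m' q = {(a, b) \<in> R. m' a \<noteq> Some b \<and> m' b \<noteq> Some a}"
    using uvm by (auto simp: real_steps_def Rq)
  have real_p: "real_steps m p = insert (x, y) (real_steps m' q)"
  proof -
    have "(u, x) \<notin> real_steps m p" "(y, v) \<notin> real_steps m p" using x y by (auto simp: real_steps_def)
    moreover have "m x \<noteq> Some y" "m y \<noteq> Some x" using x y ne vx by auto
    ultimately show ?thesis
      unfolding real_q unfolding real_steps_def Rp using R_iff by (auto split: if_splits)
  qed
  have "bij_betw gap (insert (x, y) (real_steps m' q)) (insert (Suc d) {1..d})"
  proof -
    have "(x, y) \<notin> real_steps m' q"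
      using bij_betwE[OF bij] gap by fastforce
    then show ?thesis
      using notIn_Un_bij_betw[of "(x, y)" "real_steps m' q" gap "{1..d}"] bij gap by simp
  qed
  then have bp: "bij_betw gap (real_steps m p) {1..Suc d}"
    by (simp add: real_p atLeastAtMostSuc_conv)
  have ap: "(a, b) \<in> steps p \<or> (b, a) \<in> steps p" if ab: "m a = Some b" "a \<noteq> b" for a b
  proof -
    consider "a = x" | "a = y" | "a = u" "a \<noteq> x" | "a = v" "a \<noteq> y" | "a \<notin> {x, y, u, v}" by auto
    then show ?thesis
    proof cases
      case 1 then show ?thesis using ab x by (auto simp: Rp)
    next
      case 2 then show ?thesis using ab y by (auto simp: Rp)
    next
      case 3
      then have "b = x" using ab mu by auto
      then show ?thesis using 3 by (auto simp: Rp)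
    next
      case 4
      then have "b = y" using ab mv by auto
      then show ?thesis using 4 by (auto simp: Rp)
    next
      case 5
      then have "(a, b) \<in> steps q \<or> (b, a) \<in> steps q"
        using adj[of a b] keep[of a] ab by auto
      then show ?thesis using 5 by (auto simp: Rq Rp)
    qed
  qed
  have "p \<in> completions m (Suc d)"
    using dp hp sp ap bp by (auto simp: completions_def)
  then show ?thesis using fp by (intro bexI[of _ p]) (auto simp: Rp)
qed

text \<open>A completion may run through the new fragment in either direction; exchanging x and y
  reduces one case to the other. Since filtering p gives back q, different q have different
  extensions.\<close>

lemma extend:
  assumes q: "q \<in> completions m' d"
  shows "\<exists>p \<in> completions m (Suc d). filter (\<lambda>z. z \<in> insert (-1) (dom m')) p = q \<and>
    ((x, y) \<in> steps p \<or> (y, x) \<in> steps p)"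
proof -
  have "m' u = Some v \<or> m' v = Some u" using ne by (auto simp: join_def)
  then have "(u, v) \<in> steps q \<or> (v, u) \<in> steps q"
    using q ne unfolding completions_def by blast
  then show ?thesis
  proof
    assume "(u, v) \<in> steps q"
    then show ?thesis using extend_aux[OF q] by blast
  next
    assume vu: "(v, u) \<in> steps q"
    interpret s: joining m y v x u d by (rule swap)
    show ?thesis using s.extend_aux[unfolded join_swap, OF q vu] by blast
  qed
qed

end

section \<open>Counting completions by the edge of largest remaining difference\<close>

lemma real_stepsI:
  assumes "joining m x u y v d" "(x, y) \<in> steps p \<or> (y, x) \<in> steps p"
  shows "\<exists>e \<in> real_steps m p. gap e = Suc d \<and> (e = (x, y) \<or> e = (y, x))"
proof -
  interpret joining m x u y v d by fact
  have "m x \<noteq> Some y" "m y \<noteq> Some x" using x y ne vx by auto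
  moreover have "gap (y, x) = gap (x, y)" by (simp add: gap_def abs_minus_commute)
  ultimately have "((x, y) \<in> steps p \<longrightarrow> (x, y) \<in> real_steps m p) \<and> gap (x, y) = Suc d"
    "((y, x) \<in> steps p \<longrightarrow> (y, x) \<in> real_steps m p) \<and> gap (y, x) = Suc d"
    using gap by (simp_all add: real_steps_def)
  then show ?thesis using assms(2) by blast
qed

text \<open>\<open>gap\<close> is injective on the real steps of a completion, so only one of them
  has gap \<open>Suc d\<close>. The completions that use different candidate edges of that gap are
  therefore disjoint, and the contributions add up.\<close>

lemma sum_completions_le:
  assumes fin: "finite I"
    and J: "\<And>i. i \<in> I \<Longrightarrow> joining m (x i) (u i) (y i) (v i) d"
    and inj: "\<And>i j. i \<in> I \<Longrightarrow> j \<in> I \<Longrightarrow> {x i, y i} = {x j, y j} \<Longrightarrow> i = j"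
  shows "(\<Sum>i\<in>I. card (completions (join m (x i) (u i) (y i) (v i)) d)) \<le> card (completions m (Suc d))"
proof -
  define D where "D i = {p \<in> completions m (Suc d). (x i, y i) \<in> steps p \<or> (y i, x i) \<in> steps p}" for i
  have finD: "finite (D i)" for i
    using finite_completions by (simp add: D_def)
  have "card (completions (join m (x i) (u i) (y i) (v i)) d) \<le> card (D i)" if "i \<in> I" for i
  proof -
    interpret joining m "x i" "u i" "y i" "v i" d by (rule J[OF that])
    have "completions m' d \<subseteq> filter (\<lambda>z. z \<in> insert (-1) (dom m')) ` D i"
      using extend unfolding D_def by fast
    then show ?thesis by (rule surj_card_le[OF finD])
  qed
  then have "(\<Sum>i\<in>I. card (completions (join m (x i) (u i) (y i) (v i)) d)) \<le> (\<Sum>i\<in>I. card (D i))"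
    by (rule sum_mono)
  also have "\<dots> = card (\<Union>i\<in>I. D i)"
  proof (rule card_UN_disjoint[symmetric, OF fin])
    show "\<forall>i\<in>I. \<forall>j\<in>I. i \<noteq> j \<longrightarrow> D i \<inter> D j = {}"
    proof (intro ballI impI)
      fix i j assume ij: "i \<in> I" "j \<in> I" "i \<noteq> j"
      show "D i \<inter> D j = {}"
      proof (rule equals0I)
        fix p assume p: "p \<in> D i \<inter> D j"
        have b: "inj_on gap (real_steps m p)" using p by (auto simp: D_def completions_def bij_betw_def)
        from p real_stepsI[OF J[OF ij(1)], of p] obtain e where
          e: "e \<in> real_steps m p" "gap e = Suc d" "e = (x i, y i) \<or> e = (y i, x i)" by (auto simp: D_def)
        from p real_stepsI[OF J[OF ij(2)], of p] obtain f where
          f: "f \<in> real_steps m p" "gap f = Suc d" "f = (x j, y j) \<or> f = (y j, x j)" by (auto simp: D_def)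
        have "e = f" using inj_onD[OF b _ e(1) f(1)] e(2) f(2) by simp
        then have "{x i, y i} = {x j, y j}" using e(3) f(3) by auto
        then show False using inj ij by blast
      qed
    qed
  qed (use finD in auto)
  also have "\<dots> \<le> card (completions m (Suc d))"
    by (rule card_mono[OF finite_completions]) (auto simp: D_def)
  finally show ?thesis .
qed

section \<open>Boundary states\<close>

text \<open>
  In a state (L, H, k) the list L describes the lowest labels Lo 0, Lo 1, ... and H the highest ones
  Hi 0, Hi 1, ... (counted downwards), in the encoding above with Start for -1; labels beyond
  the lists are untouched. The slack k is the amount by which the distance of Lo 0 and Hi 0 exceeds
  the next difference to be placed, so that this difference joins some Lo i to Hi (k - i).
\<close>

datatype site = Start | Lo nat | Hi nat

type_synonym row = "site option list"
type_synonym state = "row \<times> row \<times> nat"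

fun mirror :: "site \<Rightarrow> site" where
  "mirror Start = Start"
| "mirror (Lo i) = Hi i"
| "mirror (Hi i) = Lo i"

fun reflect :: "state \<Rightarrow> state" where
  "reflect (L, H, k) = (map (map_option mirror) H, map (map_option mirror) L, k)"

definition entry :: "(nat \<Rightarrow> site) \<Rightarrow> row \<Rightarrow> nat \<Rightarrow> site option" where
  "entry f R i = (if i < length R then R ! i else Some (f i))"

definition put :: "(nat \<Rightarrow> site) \<Rightarrow> nat \<Rightarrow> site option \<Rightarrow> row \<Rightarrow> row" where
  "put f i e R = (R @ map (\<lambda>j. Some (f j)) [length R..<Suc i])[i := e]"

fun set_site :: "site \<Rightarrow> site option \<Rightarrow> state \<Rightarrow> state" where
  "set_site Start e S = S"
| "set_site (Lo i) e (L, H, k) = (put Lo i e L, H, k)"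
| "set_site (Hi i) e (L, H, k) = (L, put Hi i e H, k)"

fun shift :: "nat \<Rightarrow> nat \<Rightarrow> site \<Rightarrow> site" where
  "shift a b Start = Start"
| "shift a b (Lo i) = Lo (i - a)"
| "shift a b (Hi i) = Hi (i - b)"

definition lead :: "row \<Rightarrow> nat" where
  "lead R = length (takeWhile (\<lambda>e. e = None) R)"

text \<open>The test only guards against truncated subtraction.\<close>

fun trim :: "state \<Rightarrow> state option" where
  "trim (L, H, k) = (let a = lead L; b = lead H in
     if a + b \<le> Suc k
     then Some (map (map_option (shift a b)) (drop a L), map (map_option (shift a b)) (drop b H), Suc k - (a + b))
     else None)"

text \<open>The order of the updates matters: both endpoints are cleared first, and an untouched
  endpoint is then reinstated as an end of the new fragment, because there u or v is the endpoint
  itself.\<close>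

fun link :: "state \<Rightarrow> nat \<Rightarrow> state option" where
  "link (L, H, k) i =
     (case entry Lo L i of None \<Rightarrow> None | Some u \<Rightarrow>
      case entry Hi H (k - i) of None \<Rightarrow> None | Some v \<Rightarrow>
        if u = v \<or> u = Hi (k - i) then None
        else trim (set_site v (Some u) (set_site u (Some v)
               (set_site (Hi (k - i)) None (set_site (Lo i) None (L, H, k))))))"

definition slack :: "state \<Rightarrow> nat" where
  "slack S = snd (snd S)"

text \<open>
  The sites of a state are placed in an interval of N + 1 labels, read upwards (s = 1)
  or downwards (s = -1).
\<close>

fun place :: "int \<Rightarrow> int \<Rightarrow> nat \<Rightarrow> site \<Rightarrow> int" where
  "place t s N Start = -1"
| "place t s N (Lo i) = t + s * int i"
| "place t s N (Hi i) = t + s * (int N - int i)"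

text \<open>Each row prescribes m up to the place where the other list begins. A label between the
  two lists is thus named from both sides, and both descriptions call it untouched. Labels outside
  the interval are saturated.\<close>

fun represents :: "state \<Rightarrow> int \<Rightarrow> int \<Rightarrow> nat \<Rightarrow> (int \<Rightarrow> int option) \<Rightarrow> bool" where
  "represents (L, H, k) t s N m \<longleftrightarrow>
     (s = 1 \<or> s = -1) \<and> length L + length H \<le> N \<and> (\<forall>i\<le>N. 0 \<le> t + s * int i) \<and>
     (\<forall>i. i + length H \<le> N \<longrightarrow> m (place t s N (Lo i)) = map_option (place t s N) (entry Lo L i)) \<and>
     (\<forall>i. i + length L \<le> N \<longrightarrow> m (place t s N (Hi i)) = map_option (place t s N) (entry Hi H i)) \<and>
     (\<forall>z. m z \<noteq> None \<longrightarrow> (\<exists>i\<le>N. z = t + s * int i))"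

section \<open>Placements under reflection, updates and trimming\<close>

lemma representsD:
  assumes "represents (L, H, k) t s N m"
  shows "s = 1 \<or> s = -1" "length L + length H \<le> N" "i \<le> N \<Longrightarrow> 0 \<le> t + s * int i"
    "i + length H \<le> N \<Longrightarrow> m (place t s N (Lo i)) = map_option (place t s N) (entry Lo L i)"
    "i + length L \<le> N \<Longrightarrow> m (place t s N (Hi i)) = map_option (place t s N) (entry Hi H i)"
    "m z \<noteq> None \<Longrightarrow> \<exists>i\<le>N. z = t + s * int i"
  using assms unfolding represents.simps by blast+

lemma place_mirror: "place (t + s * int N) (- s) N (mirror a) = place t s N a"
  by (cases a) (auto simp: algebra_simps)

lemma entry_mirror:
  assumes "\<And>i. mirror (f i) = g i"
  shows "entry g (map (map_option mirror) R) i = map_option mirror (entry f R i)"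
  using assms by (auto simp: entry_def)

text \<open>The map is unchanged and merely read from the far end: the new base is the label of
  \<open>Hi 0\<close> and the direction flips.\<close>

lemma represents_reflect:
  assumes "represents S t s N m"
  shows "represents (reflect S) (t + s * int N) (- s) N m"
proof -
  obtain L H k where S: "S = (L, H, k)" by (cases S)
  let ?p = "place t s N" and ?q = "place (t + s * int N) (- s) N"
  have q: "?q \<circ> mirror = ?p" by (auto simp: place_mirror)
  have pos: "0 \<le> t + s * int N + - s * int i" if "i \<le> N" for i
  proof -
    have "0 \<le> t + s * int (N - i)" using assms by (simp add: S)
    then show ?thesis using that by (simp add: of_nat_diff algebra_simps)
  qed
  have lo: "m (?q (Lo i)) = map_option ?q (entry Lo (map (map_option mirror) H) i)" if "i + length L \<le> N" for i
  proof -
    have "m (?p (Hi i)) = map_option ?p (entry Hi H i)" using assms that by (simp add: S)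
    then show ?thesis
      by (simp only: place_mirror[of t s N "Hi i", symmetric] mirror.simps entry_mirror[of Hi Lo] option.map_comp q)
  qed
  have hi: "m (?q (Hi i)) = map_option ?q (entry Hi (map (map_option mirror) L) i)" if "i + length H \<le> N" for i
  proof -
    have "m (?p (Lo i)) = map_option ?p (entry Lo L i)" using assms that by (simp add: S)
    then show ?thesis
      by (simp only: place_mirror[of t s N "Lo i", symmetric] mirror.simps entry_mirror[of Lo Hi] option.map_comp q)
  qed
  have dom: "\<exists>i\<le>N. z = t + s * int N + - s * int i" if "m z \<noteq> None" for z
  proof -
    have "\<exists>i\<le>N. z = t + s * int i" by (rule representsD(6)[OF assms[unfolded S] that])
    then obtain i where "i \<le> N" "z = t + s * int i" by blast
    then show ?thesis by (intro exI[of _ "N - i"]) (auto simp: of_nat_diff algebra_simps)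
  qed
  show ?thesis
    using assms pos lo hi dom by (auto simp: S simp del: place.simps)
qed

lemma length_put: "length (put f i e R) = max (length R) (Suc i)"
  by (auto simp: put_def)

lemma entry_put: "entry f (put f i e R) j = (if j = i then e else entry f R j)"
proof (cases "j < length (put f i e R)")
  case True
  then show ?thesis
    unfolding entry_def using True by (auto simp: put_def nth_list_update nth_append simp del: upt_Suc)
next
  case False
  then show ?thesis unfolding entry_def by (auto simp: length_put)
qed

text \<open>When \<open>l + h \<le> N\<close>, the low sites with index below l and the high sites
  with index below h occupy different labels, so \<open>place\<close> is injective on the sites
  inside these bounds.\<close>

fun inside :: "nat \<Rightarrow> nat \<Rightarrow> site \<Rightarrow> bool" where
  "inside l h Start \<longleftrightarrow> True"
| "inside l h (Lo i) \<longleftrightarrow> i < l"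
| "inside l h (Hi i) \<longleftrightarrow> i < h"

fun fits :: "nat \<Rightarrow> nat \<Rightarrow> state \<Rightarrow> bool" where
  "fits l h (L, H, k) \<longleftrightarrow> length L \<le> l \<and> length H \<le> h"

lemma fits_set_site: "fits l h S \<Longrightarrow> inside l h a \<Longrightarrow> fits l h (set_site a e S)"
  by (cases S; cases a) (auto simp: length_put)

lemma represents_neg: "represents S t s N m \<Longrightarrow> m (-1) = None"
  by (cases S) (force simp del: not_None_eq)

lemma represents_set_Lo:
  assumes r: "represents (L, H, k) t s N m" and len: "max (length L) (Suc i) + length H \<le> N"
  shows "represents (put Lo i e L, H, k) t s N (m(place t s N (Lo i) := map_option (place t s N) e))"
proof -
  have s: "s \<noteq> 0" using r by auto
  have ne: "t + s * (int N - int j) \<noteq> t + s * int i" if "j + max (length L) (Suc i) \<le> N" for j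
  proof -
    have "int N - int j \<noteq> int i" using that by linarith
    then show ?thesis using s by simp
  qed
  show ?thesis
    using r len ne s by (auto simp: entry_put length_put)
qed

text \<open>For \<open>Start\<close> the first update would write to the label -1 while
  \<open>set_site\<close> changes nothing; the reset at -1 repairs this and matches the reset in
  \<open>join\<close>.\<close>

lemma represents_set_site:
  assumes r: "represents S t s N m" and f: "fits l h S" "inside l h a" "l + h \<le> N"
  shows "represents (set_site a e S) t s N ((m(place t s N a := map_option (place t s N) e))(-1 := None))"
proof -
  obtain L H k where S: "S = (L, H, k)" by (cases S)
  have pos: "0 \<le> t + s * int i" if "i \<le> N" for i using r that by (auto simp: S)
  show ?thesis
  proof (cases a)
    case Start
    then show ?thesis using r represents_neg[OF r] by (simp add: fun_upd_idem)
  next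
    case (Lo i)
    have "represents (put Lo i e L, H, k) t s N (m(place t s N (Lo i) := map_option (place t s N) e))"
      using r f by (intro represents_set_Lo) (auto simp: S Lo)
    moreover from represents_neg[OF this]
    have "(m(place t s N (Lo i) := map_option (place t s N) e)) (-1) = None" .
    ultimately show ?thesis by (simp add: S Lo fun_upd_idem)
  next
    case (Hi i)
    let ?t = "t + s * int N"
    \<comment> \<open>The high case is the low case seen from the other end.\<close>
    have R: "represents (reflect S) ?t (- s) N m" by (rule represents_reflect[OF r])
    have "represents (put Lo i (map_option mirror e) (map (map_option mirror) H), map (map_option mirror) L, k) ?t (- s) N
       (m(place ?t (- s) N (Lo i) := map_option (place ?t (- s) N) (map_option mirror e)))"
      using R f by (intro represents_set_Lo) (auto simp: S Hi)
    from represents_reflect[OF this]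
    have r': "represents (map (map_option mirror) (map (map_option mirror) L),
        map (map_option mirror) (put Lo i (map_option mirror e) (map (map_option mirror) H)), k) t s N
       (m(place ?t (- s) N (Lo i) := map_option (place ?t (- s) N) (map_option mirror e)))"
      by (simp add: algebra_simps)
    have mm: "mirror (mirror b) = b" for b by (cases b) auto
    then have mm': "mirror \<circ> mirror = id" by auto
    have e1: "map (map_option mirror) (put Lo i (map_option mirror e) (map (map_option mirror) H)) = put Hi i e H"
      by (simp add: put_def map_update mm' option.map_comp comp_def mm option.map_ident)
    have e2: "map (map_option mirror) (map (map_option mirror) L) = L"
      by (simp add: option.map_comp comp_def mm option.map_ident)
    have e3: "place ?t (- s) N (Lo i) = place t s N (Hi i)"
      by (simp add: algebra_simps)
    have e4: "map_option (place ?t (- s) N) (map_option mirror e) = map_option (place t s N) e"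
      by (simp add: option.map_comp comp_def place_mirror)
    have r'': "represents (set_site a e S) t s N (m(place t s N a := map_option (place t s N) e))"
      using r' unfolding S Hi set_site.simps e1 e2 e3 e4 .
    from represents_neg[OF this] show ?thesis using r'' by (simp add: fun_upd_idem)
  qed
qed

lemma lead_le: "lead R \<le> length R"
  by (simp add: lead_def length_takeWhile_le)

lemma entry_lead: "i < lead R \<Longrightarrow> entry f R i = None"
  using takeWhile_nth[of i "\<lambda>e. e = None" R] set_takeWhileD[of "R ! i" "\<lambda>e. e = None" R] nth_mem[of i "takeWhile (\<lambda>e. e = None) R"] lead_le[of R]
  by (auto simp: lead_def entry_def)

lemma entry_drop:
  assumes "\<And>i. g (f (a + i)) = f i" "a \<le> length R"
  shows "entry f (map (map_option g) (drop a R)) i = map_option g (entry f R (a + i))"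
  using assms by (auto simp: entry_def nth_drop)

text \<open>Here the edge of difference \<open>Suc d\<close> is already placed but the slack is
  still the old one. The danger is the truncated subtraction in \<open>shift\<close>: it is harmless
  because, by \<open>mates\<close>, an entry points to an unsaturated label or to -1, hence never to
  a dropped site.\<close>

lemma represents_trim:
  assumes r: "represents (L, H, k) t s N m" and m: "mates m" and S': "trim (L, H, k) = Some S'"
    and N: "N = Suc d + k"
  shows "\<exists>t'. represents S' t' s (d + slack S') m"
proof -
  define a b where "a = lead L" and "b = lead H"
  define N' where "N' = N - (a + b)"
  define t' where "t' = t + s * int a"
  have ab: "a + b \<le> Suc k" and S'_eq: "S' = (map (map_option (shift a b)) (drop a L),
      map (map_option (shift a b)) (drop b H), Suc k - (a + b))"
    using S' by (auto simp: a_def b_def Let_def split: if_splits)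
  have aL: "a \<le> length L" and bH: "b \<le> length H" by (simp_all add: a_def b_def lead_le)
  have len: "length L + length H \<le> N" using r by simp
  have N': "N' = d + slack S'" "int N' = int N - int a - int b" "a + b \<le> N"
    using ab N by (auto simp: N'_def S'_eq slack_def)
  have lo: "m (place t s N (Lo i)) = map_option (place t s N) (entry Lo L i)" if "i + length H \<le> N" for i
    using r that by simp
  have hi: "m (place t s N (Hi i)) = map_option (place t s N) (entry Hi H i)" if "i + length L \<le> N" for i
    using r that by simp
  have loN: "m (place t s N (Lo i)) = None" if "i < a" for i
    using lo[of i] that aL len entry_lead[of i L] by (simp add: a_def)
  have hiN: "m (place t s N (Hi i)) = None" if "i < b" for i
    using hi[of i] that bH len entry_lead[of i H] by (simp add: b_def)
  have pl: "place t' s N' (Lo i) = place t s N (Lo (a + i))" "place t' s N' (Hi i) = place t s N (Hi (b + i))" for i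
    unfolding place.simps t'_def N'(2) by (simp_all add: algebra_simps)
  have shift: "map_option (place t' s N') (map_option (shift a b) e) = map_option (place t s N) e"
    if "m z = map_option (place t s N) e" for z e
  proof (cases e)
    case (Some c)
    have "m z = Some (place t s N c)" using that Some by simp
    then have c: "place t s N c = -1 \<or> m (place t s N c) \<noteq> None" using m by (auto simp: mates_def)
    have neg: "place t s N c \<noteq> -1" if "c = Lo i \<and> i < a \<or> c = Hi i \<and> i < b" for i
    proof -
      have pos: "0 \<le> t + s * int j" if "j \<le> N" for j using r that by simp
      show ?thesis using that pos[of i] pos[of "N - i"] N'(3) by (auto simp: of_nat_diff)
    qed
    have "place t' s N' (shift a b c) = place t s N c"
    proof (cases c)
      case Start then show ?thesis by simp
    next
      case (Lo i)
      have "\<not> i < a" using c loN[of i] neg[of i] Lo by auto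
      then show ?thesis using pl(1)[of "i - a"] Lo by simp
    next
      case (Hi i)
      have "\<not> i < b" using c hiN[of i] neg[of i] Hi by auto
      then show ?thesis using pl(2)[of "i - b"] Hi by simp
    qed
    then show ?thesis using Some by simp
  qed simp
  have lo': "m (place t' s N' (Lo i)) = map_option (place t' s N') (entry Lo (map (map_option (shift a b)) (drop a L)) i)"
    if "i + (length H - b) \<le> N'" for i
  proof -
    have i: "a + i + length H \<le> N" using that bH N' by linarith
    show ?thesis
      using shift[OF lo[OF i]] lo[OF i] entry_drop[of "shift a b" Lo a L i] aL by (simp only: pl) simp
  qed
  have hi': "m (place t' s N' (Hi i)) = map_option (place t' s N') (entry Hi (map (map_option (shift a b)) (drop b H)) i)"
    if "i + (length L - a) \<le> N'" for i
  proof -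
    have i: "b + i + length L \<le> N" using that aL N' by linarith
    show ?thesis
      using shift[OF hi[OF i]] hi[OF i] entry_drop[of "shift a b" Hi b H i] bH by (simp only: pl) simp
  qed
  have pos': "0 \<le> t' + s * int i" if "i \<le> N'" for i
  proof -
    have "a + i \<le> N" using that N' by linarith
    then have "0 \<le> t + s * int (a + i)" by (rule representsD(3)[OF r])
    then show ?thesis by (simp add: t'_def algebra_simps)
  qed
  have dom': "\<exists>i\<le>N'. z = t' + s * int i" if "m z \<noteq> None" for z
  proof -
    have "\<exists>i\<le>N. z = t + s * int i" by (rule representsD(6)[OF r that])
    then obtain i where i: "i \<le> N" "z = t + s * int i" by blast
    have "\<not> i < a" using loN[of i] that i by auto
    moreover have "\<not> N - i < b"
    proof
      assume "N - i < b"
      then have "m (place t s N (Hi (N - i))) = None" by (rule hiN)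
      then show False using that i by (simp add: of_nat_diff)
    qed
    ultimately show ?thesis using i N' by (intro exI[of _ "i - a"]) (auto simp: t'_def of_nat_diff algebra_simps)
  qed
  have "represents S' t' s N' m"
    using r lo' hi' pos' dom' N' aL bH len unfolding S'_eq by (auto simp del: place.simps)
  then show ?thesis using N' by blast
qed

text \<open>The bound 14 keeps the sites Lo and Hi apart as long as the interval has at least 15 labels.\<close>

fun bounded :: "state \<Rightarrow> bool" where
  "bounded (L, H, k) \<longleftrightarrow> max (length L) (Suc k) + max (length H) (Suc k) \<le> 14 \<and>
     list_all (\<lambda>e. case e of None \<Rightarrow> True | Some a \<Rightarrow> inside (length L) (length H) a) (L @ H)"

section \<open>One edge, followed on states and on maps\<close>

lemma inside_mono: "inside l h a \<Longrightarrow> l \<le> l' \<Longrightarrow> h \<le> h' \<Longrightarrow> inside l' h' a"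
  by (cases a) auto

lemma inside_entry:
  assumes "list_all (\<lambda>e. case e of None \<Rightarrow> True | Some a \<Rightarrow> inside l h a) R" "entry f R i = Some a"
    "inside l' h' (f i)" "l \<le> l'" "h \<le> h'"
  shows "inside l' h' a"
proof (cases "i < length R")
  case True
  then have "R ! i = Some a" "R ! i \<in> set R" using assms(2) nth_mem[OF True] by (auto simp: entry_def)
  then show ?thesis using assms inside_mono by (fastforce simp: list_all_iff)
next
  case False
  then show ?thesis using assms(2,3) by (simp add: entry_def)
qed

lemma link_represents:
  assumes r: "represents S t s N m" and m: "mates m" and bd: "bounded S" and N: "N = Suc d + slack S" "14 \<le> N"
    and i: "i \<le> slack S" and l: "link S i = Some S'"
  defines "x \<equiv> place t s N (Lo i)" and "y \<equiv> place t s N (Hi (slack S - i))"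
  shows "joining m x (the (m x)) y (the (m y)) d \<and>
    (\<exists>t'. represents S' t' s (d + slack S') (join m x (the (m x)) y (the (m y))))"
proof -
  obtain L H k where S: "S = (L, H, k)" by (cases S)
  have k: "slack S = k" by (simp add: S slack_def)
  define p where "p = place t s N"
  \<comment> \<open>The bounds reach at least to index k, so that both endpoints of the new edge are
    covered even where the lists are shorter.\<close>
  define lw where "lw = max (length L) (Suc k)"
  define h where "h = max (length H) (Suc k)"
  have lh: "lw + h \<le> N" using bd N by (simp add: S lw_def h_def)
  obtain u v where u: "entry Lo L i = Some u" and v: "entry Hi H (k - i) = Some v"
    and uv: "u \<noteq> v" "u \<noteq> Hi (k - i)"
    and tr: "trim (set_site v (Some u) (set_site u (Some v)
               (set_site (Hi (k - i)) None (set_site (Lo i) None S)))) = Some S'"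
    using l by (auto simp: S split: option.splits if_splits)
  have la: "list_all (\<lambda>e. case e of None \<Rightarrow> True | Some a \<Rightarrow> inside (length L) (length H) a) L"
    "list_all (\<lambda>e. case e of None \<Rightarrow> True | Some a \<Rightarrow> inside (length L) (length H) a) H"
    using bd by (auto simp: S)
  have iu: "inside lw h u"
    using inside_entry[OF la(1) u, of lw h] i k by (simp add: lw_def h_def)
  have iv: "inside lw h v"
    using inside_entry[OF la(2) v, of lw h] i k by (simp add: lw_def h_def)
  have ix: "inside lw h (Lo i)" "inside lw h (Hi (k - i))" using i k by (auto simp: lw_def h_def)
  have pos: "0 \<le> t + s * int j" if "j \<le> N" for j using r that by (simp add: S)
  have s: "s = 1 \<or> s = -1" using r by (simp add: S)
  have p_inj: "a = b" if ab: "inside lw h a" "inside lw h b" "p a = p b" for a b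
  proof -
    have neg: "p c \<noteq> -1" if "inside lw h c" "c \<noteq> Start" for c
      using that pos[of "case c of Lo i \<Rightarrow> i | Hi i \<Rightarrow> N - i | Start \<Rightarrow> 0"] lh
      by (cases c) (auto simp: p_def of_nat_diff)
    show ?thesis
      using ab neg[of a] neg[of b] s lh by (cases a; cases b) (auto simp: p_def)
  qed
  have mx: "m x = Some (p u)"
    using representsD(4)[OF r[unfolded S], of i] u i lh k unfolding x_def p_def
    by (auto simp: lw_def h_def simp del: place.simps)
  have my: "m y = Some (p v)"
    using representsD(5)[OF r[unfolded S], of "k - i"] v i lh k unfolding y_def p_def
    by (auto simp: lw_def h_def simp del: place.simps)
  have J: "joining m x (p u) y (p v) d"
  proof
    show "p u \<noteq> y" using p_inj[OF iu ix(2)] uv by (auto simp: p_def y_def k)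
    show "p u \<noteq> p v" using p_inj[OF iu iv] uv by auto
    show "gap (x, y) = Suc d"
      using i k N s by (auto simp: gap_def x_def y_def of_nat_diff algebra_simps)
  qed (use m mx my in auto)
  then interpret joining m x "p u" y "p v" d .
  have f0: "fits lw h S" by (simp add: S lw_def h_def)
  note f1 = fits_set_site[OF f0 ix(1), of None]
  note f2 = fits_set_site[OF f1 ix(2), of None]
  note f3 = fits_set_site[OF f2 iu, of "Some v"]
  note r1 = represents_set_site[OF r f0 ix(1) lh, of None]
  note r2 = represents_set_site[OF r1 f1 ix(2) lh, of None]
  note r3 = represents_set_site[OF r2 f2 iu lh, of "Some v"]
  note r4 = represents_set_site[OF r3 f3 iv lh, of "Some u"]
  \<comment> \<open>The resets at -1 between the four updates collapse into the final one of
    \<open>join\<close>.\<close>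
  have "(((((((m(x := None))(-1 := None))(y := None))(-1 := None))(p u := Some (p v)))(-1 := None))(p v := Some (p u)))(-1 := None)
     = join m x (p u) y (p v)"
    by (auto simp: join_def fun_eq_iff)
  then have r5: "represents (set_site v (Some u) (set_site u (Some v)
               (set_site (Hi (k - i)) None (set_site (Lo i) None S)))) t s N (join m x (p u) y (p v))"
    using r4 unfolding x_def y_def p_def k by (simp del: place.simps)
  have slk: "slack (set_site a e T) = slack T" for a e T
    by (cases a; cases T) (auto simp: slack_def)
  obtain L' H' k' where T: "set_site v (Some u) (set_site u (Some v)
               (set_site (Hi (k - i)) None (set_site (Lo i) None S))) = (L', H', k')"
    by (metis prod_cases3)
  have "k' = k" using arg_cong[OF T, of slack] by (simp add: slk k) (simp add: slack_def)
  then have "\<exists>t'. represents S' t' s (d + slack S') (join m x (p u) y (p v))"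
    using represents_trim[OF r5[unfolded T] mates_join tr[unfolded T]] N k by simp
  then show ?thesis using J mx my by simp
qed

text \<open>The bound is uniform in position, direction and map, so it applies again to whatever
  configuration an edge leaves behind. The interval length is forced: by the meaning of the slack,
  \<open>Lo 0\<close> and \<open>Hi 0\<close> are \<open>d + slack S\<close> apart.\<close>

definition at_least :: "state \<Rightarrow> nat \<Rightarrow> real \<Rightarrow> bool" where
  "at_least S d K \<longleftrightarrow> (\<forall>t s m. represents S t s (d + slack S) m \<longrightarrow> mates m \<longrightarrow>
     K \<le> real (card (completions m d)))"

lemma at_least_reflect:
  assumes "at_least (reflect S) d K"
  shows "at_least S d K"
proof -
  have "slack (reflect S) = slack S" by (cases S) (simp add: slack_def)
  then show ?thesis
    using assms represents_reflect unfolding at_least_def by metis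
qed

text \<open>The candidates for difference \<open>Suc d\<close> are the pairs \<open>Lo i\<close>,
  \<open>Hi (slack S - i)\<close>, and \<open>sum_completions_le\<close> adds up their
  contributions. With \<open>13 \<le> d\<close> the ends are at least 14 apart, the length for which
  \<open>bounded\<close> is designed.\<close>

lemma at_least_step:
  assumes bd: "bounded S" and d: "13 \<le> d"
    and f: "\<And>i S'. i \<le> slack S \<Longrightarrow> link S i = Some S' \<Longrightarrow> at_least S' d (f S')"
  shows "at_least S (Suc d) (\<Sum>i\<le>slack S. case link S i of None \<Rightarrow> 0 | Some S' \<Rightarrow> f S')"
  unfolding at_least_def
proof (intro allI impI)
  fix t s m
  define N where "N = Suc d + slack S"
  assume "represents S t s (Suc d + slack S) m" and m: "mates m"
  then have r: "represents S t s N m" by (simp add: N_def)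
  define I where "I = {i \<in> {..slack S}. link S i \<noteq> None}"
  define x where "x i = place t s N (Lo i)" for i
  define y where "y i = place t s N (Hi (slack S - i))" for i
  have L: "joining m (x i) (the (m (x i))) (y i) (the (m (y i))) d \<and>
    (\<exists>t'. represents S' t' s (d + slack S') (join m (x i) (the (m (x i))) (y i) (the (m (y i)))))"
    if "i \<le> slack S" "link S i = Some S'" for i S'
    unfolding x_def y_def using d that by (intro link_represents[OF r m bd]) (simp_all add: N_def)
  have s: "s \<noteq> 0" using r by (cases S) auto
  have sum: "(\<Sum>i\<in>I. card (completions (join m (x i) (the (m (x i))) (y i) (the (m (y i)))) d)) \<le> card (completions m (Suc d))"
  proof (rule sum_completions_le)
    show "joining m (x i) (the (m (x i))) (y i) (the (m (y i))) d" if "i \<in> I" for i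
      using that L by (auto simp: I_def)
    show "i = j" if "i \<in> I" "j \<in> I" "{x i, y i} = {x j, y j}" for i j
    proof -
      have ij: "i \<le> slack S" "j \<le> slack S" using that by (auto simp: I_def)
      have "x i = x j \<or> x i = y j" using that(3) by blast
      moreover have "x i \<noteq> y j"
      proof -
        \<comment> \<open>Low endpoints have index at most 6 and high endpoints lie at index at
          least 14 from below, so two edges can agree as sets only with the same
          orientation.\<close>
        have "slack S \<le> 6" using bd by (cases S) (auto simp: slack_def)
        then have "int i \<noteq> int N - int (slack S - j)" using ij d by (auto simp: N_def)
        then show ?thesis using s by (simp add: x_def y_def)
      qed
      ultimately show ?thesis using s by (simp add: x_def)
    qed
  qed (simp add: I_def)
  have "(\<Sum>i\<le>slack S. case link S i of None \<Rightarrow> 0 | Some S' \<Rightarrow> f S') = (\<Sum>i\<in>I. f (the (link S i)))"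
    unfolding I_def by (rule sum.mono_neutral_cong_right) (auto split: option.splits)
  also have "\<dots> \<le> (\<Sum>i\<in>I. real (card (completions (join m (x i) (the (m (x i))) (y i) (the (m (y i)))) d)))"
  proof (rule sum_mono)
    fix i assume "i \<in> I"
    then obtain S' where S': "i \<le> slack S" "link S i = Some S'" by (auto simp: I_def)
    obtain t' where t': "represents S' t' s (d + slack S') (join m (x i) (the (m (x i))) (y i) (the (m (y i))))"
      using L[OF S'] by blast
    interpret joining m "x i" "the (m (x i))" "y i" "the (m (y i))" d using L[OF S'] by blast
    have "f S' \<le> real (card (completions m' d))"
      using f[OF S'] t' mates_join unfolding at_least_def by blast
    then show "f (the (link S i)) \<le> real (card (completions m' d))"
      using S'(2) by (simp only: option.sel)
  qed
  also have "\<dots> \<le> real (card (completions m (Suc d)))"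
    using of_nat_mono[OF sum, where 'a = real] by (simp only: of_nat_sum)
  finally show "(\<Sum>i\<le>slack S. case link S i of None \<Rightarrow> 0 | Some S' \<Rightarrow> f S') \<le> real (card (completions m (Suc d)))" .
qed

section \<open>The certificate\<close>

text \<open>A prefix code, in which no entry starts with the separator 011 of the two lists.\<close>

fun bits :: "site option \<Rightarrow> bool list" where
  "bits None = [False, False]"
| "bits (Some Start) = [False, True, False]"
| "bits (Some (Lo i)) = True # False # replicate i True @ [False]"
| "bits (Some (Hi i)) = True # True # replicate i True @ [False]"

text \<open>The slack is not part of the key; the search stores it in the trie next to the rating
  and compares it on later visits.\<close>

fun key :: "state \<Rightarrow> bool list" where
  "key (L, H, k) = concat (map bits L) @ False # True # True # concat (map bits H)"

fun key_ge :: "bool list \<Rightarrow> bool list \<Rightarrow> bool" where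
  "key_ge xs [] = True"
| "key_ge [] (y # ys) = False"
| "key_ge (True # xs) (True # ys) = key_ge xs ys"
| "key_ge (False # xs) (False # ys) = key_ge xs ys"
| "key_ge (True # xs) (False # ys) = True"
| "key_ge (False # xs) (True # ys) = False"

text \<open>The lexicographically larger key selects a representative of a mirror pair. Either
  choice is sound by \<open>at_least_reflect\<close>; the selection only merges states.\<close>

definition normal :: "state \<Rightarrow> state" where
  "normal S = (if key_ge (key S) (key (reflect S)) then S else reflect S)"

text \<open>A list and not a set: two edges may lead to the same normalized state, and each
  contributes its own completions.\<close>

definition nexts :: "state \<Rightarrow> state list" where
  "nexts S = map normal (List.map_filter (link S) [0..<Suc (slack S)])"

text \<open>No edge is placed yet and label 6 hangs on the start. The untouched labels 0 to 5 are
  listed only to put \<open>Start\<close> at index 6.\<close>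

definition origin :: state where
  "origin = (map (\<lambda>i. Some (Lo i)) [0..<6] @ [Some Start], [], 0)"

section \<open>Tries over bit strings and the search\<close>

datatype 'a trie = Empty | Item 'a | Left "'a trie" | Right "'a trie" | Fork "'a trie" "'a trie"

fun lookup :: "bool list \<Rightarrow> 'a trie \<Rightarrow> 'a option" where
  "lookup [] (Item a) = Some a"
| "lookup (True # bs) (Left l) = lookup bs l"
| "lookup (True # bs) (Fork l r) = lookup bs l"
| "lookup (False # bs) (Right r) = lookup bs r"
| "lookup (False # bs) (Fork l r) = lookup bs r"
| "lookup _ _ = None"

fun insert_trie :: "'a \<Rightarrow> bool list \<Rightarrow> 'a trie \<Rightarrow> 'a trie" where
  "insert_trie a [] Empty = Item a"
| "insert_trie a (True # bs) Empty = Left (insert_trie a bs Empty)"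
| "insert_trie a (False # bs) Empty = Right (insert_trie a bs Empty)"
| "insert_trie a (True # bs) (Left l) = Left (insert_trie a bs l)"
| "insert_trie a (False # bs) (Left l) = Fork l (insert_trie a bs Empty)"
| "insert_trie a (True # bs) (Right r) = Fork (insert_trie a bs Empty) r"
| "insert_trie a (False # bs) (Right r) = Right (insert_trie a bs r)"
| "insert_trie a (True # bs) (Fork l r) = Fork (insert_trie a bs l) r"
| "insert_trie a (False # bs) (Fork l r) = Fork l (insert_trie a bs r)"
| "insert_trie _ _ t = t"

text \<open>
  The rating (w, r) of a state consists of its component w in the approximate eigenvector and of its
  distance r to the initial state.
\<close>

type_synonym rating = "int \<times> int"

text \<open>\<open>w \<le> 100\<close> makes one completion enough for the bound w / 100 at the base
  of the growth induction. The second inequality is its inductive step. The rank conditions make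
  every state lead back to \<open>origin\<close> within 20 edges.\<close>

fun check :: "state \<Rightarrow> rating \<Rightarrow> rating list \<Rightarrow> bool" where
  "check S (w, r) c \<longleftrightarrow> bounded S \<and> length c = length (nexts S) \<and>
     w \<le> 100 \<and> 237 * w \<le> 100 * sum_list (map fst c) \<and>
     0 \<le> r \<and> r \<le> 20 \<and> (if r = 0 then S = origin else list_ex (\<lambda>v. snd v < r) c)"

text \<open>
  Depth-first search over the states. The list c claims the ratings of the successors of S; a claim is
  recorded when its state is visited first and compared with the record on later visits. The
  auxiliary functions dispatch on patterns because evaluation by rewriting would traverse
  the trie again in the branches of an if or case expression.
\<close>

function (sequential) explore ::
    "rating list list \<Rightarrow> (state \<times> rating) list \<Rightarrow> (nat \<times> rating) trie \<Rightarrow> bool"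
  and explore' :: "(nat \<times> rating) option \<Rightarrow> rating list list \<Rightarrow> state \<Rightarrow> rating \<Rightarrow>
    (state \<times> rating) list \<Rightarrow> (nat \<times> rating) trie \<Rightarrow> bool"
  and guard :: "bool \<Rightarrow> rating list list \<Rightarrow> (state \<times> rating) list \<Rightarrow> (nat \<times> rating) trie \<Rightarrow> bool"
where
  "explore cs [] T = True"
| "explore cs ((S, v) # Q) T = explore' (lookup (key S) T) cs S v Q T"
| "explore' (Some e) cs S v Q T = guard (e = (slack S, v)) cs Q T"
| "explore' None [] S v Q T = False"
| "explore' None (c # cs) S v Q T =
     guard (check S v c) cs (zip (nexts S) c @ Q) (insert_trie (slack S, v) (key S) T)"
| "guard True cs Q T = explore cs Q T"
| "guard False cs Q T = False"
  by pat_completeness auto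
termination
  \<comment> \<open>Only a first visit consumes a rating list. Otherwise the queue shrinks, and the
    offsets 2 and 1 order the three functions within one round.\<close>
  by (relation "measures
    [\<lambda>x. case x of Inl (cs, _) \<Rightarrow> length cs | Inr (Inl (_, cs, _)) \<Rightarrow> length cs | Inr (Inr (_, cs, _)) \<Rightarrow> length cs,
     \<lambda>x. case x of Inl (_, Q, _) \<Rightarrow> 3 * length Q | Inr (Inl (_, _, _, _, Q, _)) \<Rightarrow> 3 * length Q + 2
       | Inr (Inr (_, _, Q, _)) \<Rightarrow> 3 * length Q + 1]") auto

fun walk :: "state \<Rightarrow> nat list \<Rightarrow> state option" where
  "walk S [] = Some S"
| "walk S (i # is) = (if bounded S \<and> i < length (nexts S) then walk (nexts S ! i) is else None)"

text \<open>
  The ratings of the successors of every state, in the order of the depth-first search. The weights are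
  the entries of the Perron eigenvector, scaled to the maximum 58 and rounded.
\<close>

definition profile1 :: "rating list list" where
  "profile1 =
   [[(8,12)], [(10,12),(10,11)], [(12,12),(12,11)], [(29,11)], [(28,11),(15,10),(28,10)],
    [(32,11),(25,10),(12,10)], [(27,11),(33,10),(18,10)], [(24,11),(17,10),(26,10)], [(58,10)],
    [(28,9),(30,9),(30,9),(55,10)], [(13,10),(27,8),(29,10)], [(9,9),(12,10),(12,9)],
    [(11,13),(11,8)], [(10,12),(18,12)], [(7,13),(17,11)], [(5,12),(12,12)], [(3,13),(10,11)],
    [(8,12)], [(12,12),(12,10)], [(29,11)], [(13,9),(17,12)], [(18,12),(14,8)], [(19,12),(26,11)],
    [(33,11),(14,11)], [(35,11),(17,10),(30,10)], [(17,10),(17,10),(52,10)], [(14,9),(27,9)],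
    [(6,8),(29,8)], [(15,7)], [(23,13),(13,6)], [(37,12),(20,12)], [(28,11),(29,12),(33,11)],
    [(23,10),(22,12),(26,10)], [(9,9),(23,12),(23,9)], [(8,12),(18,11),(32,11)], [(19,11)],
    [(19,11),(29,10)], [(32,10),(14,10)], [(32,11),(17,9),(31,9)], [(14,11),(15,10),(49,10)],
    [(18,10),(16,11)], [(12,9),(31,9)], [(31,8)], [(25,7),(13,7),(37,10)],
    [(31,12),(20,6),(10,13)], [(16,12),(32,11),(29,11)], [(26,11),(14,11)],
    [(23,10),(22,11),(20,10)], [(21,10),(32,10)], [(21,12),(31,9)], [(8,11),(16,12),(28,11)],
    [(7,13),(13,10)], [(18,12),(14,9)], [(19,11),(26,11)], [(30,10),(33,11)],
    [(27,9),(26,9),(20,10)], [(21,10),(27,8),(18,8)], [(26,9),(27,9)], [(35,11),(29,8)],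
    [(16,10),(16,10),(56,10)]]"

definition profile2 :: "rating list list" where
  "profile2 =
   [[(26,9),(13,9)], [(32,10),(17,8),(13,8)], [(17,12),(32,9),(29,9)], [(28,11),(14,11)],
    [(13,10),(26,11),(30,10)], [(21,11),(13,10),(31,10)], [(10,10),(17,11),(26,10)],
    [(10,12),(14,9)], [(11,8),(23,11)], [(13,12),(14,7)], [(20,11),(11,11)],
    [(14,12),(15,10),(20,10)], [(16,11),(18,11)], [(18,11),(21,10)], [(13,10),(14,11),(17,10)],
    [(21,10),(14,10)], [(35,9)], [(27,8),(27,8),(33,11)], [(29,11),(13,7),(25,7)],
    [(29,11),(14,10),(28,10)], [(17,10),(55,10)], [(8,9),(34,9)], [(14,8),(6,8)], [(18,12),(17,7)],
    [(33,11),(12,11)], [(31,12),(30,10),(20,10)], [(26,11),(14,11),(35,11)],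
    [(22,11),(24,9),(27,9)], [(23,12),(10,8),(27,8)], [(17,12),(8,11),(31,11)], [(15,12),(28,11)],
    [(7,12),(7,11),(23,11)], [(5,12),(12,11)], [(13,10),(17,11)], [(15,12),(28,10)],
    [(18,11),(18,11)], [(14,11),(30,10)], [(34,10)], [(32,9),(31,9),(20,10)],
    [(33,11),(16,8),(29,8)], [(16,10),(14,10),(53,10)], [(34,9)], [(26,8),(26,8),(30,9)],
    [(32,12),(13,12),(21,7)], [(29,11),(16,11),(33,11)], [(25,11),(30,10),(16,10)],
    [(13,10),(18,11),(31,10)], [(16,12),(17,9)], [(21,11),(19,11)], [(16,12),(8,10),(28,10)],
    [(7,12),(7,11),(24,11)], [(5,13),(12,10)], [(3,13),(10,12)], [(22,11),(15,10),(23,10)],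
    [(29,10),(26,11)], [(23,9),(12,9),(36,10)], [(13,8),(25,8),(19,12)], [(15,11),(17,7)],
    [(12,11),(26,10)], [(13,10),(17,10)]]"

definition profile3 :: "rating list list" where
  "profile3 =
   [[(16,11),(17,9)], [(18,10),(22,10)], [(31,9),(14,9)], [(28,11),(22,8),(27,8)],
    [(28,12),(26,7)], [(12,11),(23,12),(34,11)], [(12,13),(18,10)], [(15,12),(15,12)],
    [(19,12),(24,9)], [(32,11),(15,11)], [(17,10),(17,10),(46,10)], [(55,10),(30,9),(29,9)],
    [(52,10),(28,9),(29,9),(27,9)], [(24,9),(29,9),(25,9),(51,10)], [(12,8),(25,8),(21,10)],
    [(8,9),(13,7),(8,7)], [(19,8)], [(20,12),(26,7)], [(14,12),(35,11)], [(18,11),(16,11)],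
    [(30,10),(15,10)], [(23,10),(24,9),(26,9)], [(33,9),(14,8),(18,8)], [(26,8),(25,8),(31,11)],
    [(28,11),(13,7),(23,7)], [(25,11),(17,10),(27,10)], [(13,10),(14,10),(34,11)],
    [(12,9),(20,12)], [(18,11),(33,11)], [(13,12),(13,10),(18,10)], [(13,11),(18,11)],
    [(8,11),(8,10),(15,10)], [(7,13),(13,9)], [(5,13),(12,12)], [(18,10),(18,9)], [(18,12),(27,8)],
    [(31,11),(15,11)], [(14,11),(15,10),(47,10)], [(18,10),(19,9)], [(12,9),(32,9)],
    [(34,11),(17,8),(28,8)], [(13,10),(16,10),(54,10)], [(32,9),(8,9)], [(29,12),(22,8),(27,8)],
    [(14,12),(26,11),(32,11)], [(20,11),(14,11)], [(21,11),(29,10)], [(12,11),(22,10),(31,10)],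
    [(10,10),(8,12),(12,10)], [(14,11),(17,9)], [(34,10)], [(11,11),(30,8)], [(18,10),(10,10)],
    [(11,12),(5,12),(29,9)], [(19,11),(9,11)], [(30,10),(17,10)], [(23,10)],
    [(16,10),(9,10),(30,9)], [(14,9),(8,9)], [(16,13),(19,8)]]"

definition profile4 :: "rating list list" where
  "profile4 =
   [[(21,12),(19,12)], [(20,12),(26,7)], [(35,11),(14,11)], [(14,11),(15,10),(57,10)],
    [(18,10),(16,10)], [(13,9),(32,9)], [(26,8),(6,8)], [(37,12),(26,7)], [(10,13),(21,6),(33,11)],
    [(20,12),(6,12)], [(28,11),(20,11)], [(22,12),(11,14),(36,10)], [(12,12),(24,11),(19,12)],
    [(16,12),(14,11)], [(23,12),(36,10)], [(8,12),(17,11),(30,11)], [(12,12),(8,10),(23,10)],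
    [(29,11)], [(31,9),(26,11)], [(27,8),(14,8),(34,11)], [(11,7),(22,7),(33,11)],
    [(15,10),(13,6)], [(20,12),(18,9)], [(29,8),(14,8)], [(35,10),(13,7),(23,7)],
    [(28,11),(30,9),(27,9)], [(56,10),(13,10)], [(52,11),(28,9),(29,9),(28,9)],
    [(24,11),(24,10),(25,10),(55,10)], [(13,10),(20,11),(26,10)], [(20,11),(30,10)],
    [(18,11),(31,9),(15,10)], [(18,11),(26,10)], [(31,9),(32,9)], [(27,9),(26,8),(23,8)],
    [(21,10),(26,8),(20,8)], [(32,9),(20,12)], [(16,9),(25,7),(8,7)], [(26,8),(14,8)],
    [(6,8),(13,6)], [(15,7)], [(21,12),(10,5)], [(32,11),(19,11)], [(32,12),(29,10),(18,10)],
    [(19,11),(26,9),(27,9)], [(29,10),(18,10)], [(22,12),(24,9),(25,9)], [(20,11),(33,11)],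
    [(27,8),(35,11)], [(13,7),(25,7),(29,10)], [(12,10),(10,13),(9,6)], [(18,12),(12,9)], [(31,8)],
    [(12,9),(10,5)], [(23,13),(6,8)], [(18,13),(8,4)], [(30,12),(15,12)],
    [(14,11),(28,12),(33,11)], [(16,13),(18,10)], [(22,12),(18,12)]]"

definition profile5 :: "rating list list" where
  "profile5 =
   [[(17,12),(8,11),(30,11)], [(8,11),(12,12),(22,11)], [(20,10)], [(19,12),(31,9)],
    [(18,11),(31,10),(25,10)], [(29,10),(15,11)], [(25,9),(32,9),(16,11)], [(12,8),(17,8),(32,10)],
    [(12,9),(17,7)], [(19,11),(23,6)], [(31,10),(17,10)], [(32,12),(17,12),(27,9)],
    [(51,11),(14,11),(14,11)], [(24,11),(26,10),(23,10),(53,10)], [(20,10),(21,9),(24,9)],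
    [(9,9),(19,12),(20,9)], [(21,11),(26,11)], [(30,8),(20,11)], [(25,7),(13,7),(36,10)],
    [(10,12),(19,6),(33,11)], [(18,11),(6,12)], [(19,11),(25,10)], [(37,10),(8,9),(16,9)],
    [(29,9),(31,9),(31,12)], [(24,12),(25,8),(23,8)], [(14,11),(31,12),(14,12)], [(34,10)],
    [(29,11),(13,12),(19,7)], [(34,11),(14,10),(23,10)], [(34,9)], [(32,9),(26,9)],
    [(29,9),(25,8),(25,8)], [(27,8),(10,7),(23,7)], [(30,11),(25,7),(11,7)],
    [(31,12),(20,10),(22,10)], [(13,12),(51,11),(11,12)], [(18,11),(15,11)], [(18,10),(18,11)],
    [(29,10),(17,10)], [(26,11),(15,9),(31,9)], [(12,11),(10,8),(14,8)], [(11,13),(13,7)],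
    [(10,13),(18,12)], [(7,13),(17,12)], [(15,12),(28,11)], [(12,10),(26,10),(30,11)],
    [(31,10),(12,9),(20,9)], [(27,9),(25,9),(24,11)], [(58,10)], [(18,8),(11,13)],
    [(19,12),(25,7)], [(32,11),(15,11)], [(13,10),(14,10),(51,10)], [(44,10),(24,9),(30,9),(28,9)],
    [(53,10),(30,9),(26,9)], [(25,9),(27,9),(28,9),(50,10)], [(24,11),(23,8),(13,8)],
    [(14,11),(30,10),(15,10)], [(17,11),(19,9)], [(29,10),(13,10)]]"

definition profile6 :: "rating list list" where
  "profile6 =
   [[(17,12),(13,8),(16,8)], [(27,11),(15,11)], [(12,11),(21,10),(33,10)], [(17,12),(10,9),(25,9)],
    [(10,13),(14,8)], [(13,7),(21,12)], [(20,12),(13,6)], [(20,12),(30,11)],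
    [(33,11),(21,10),(21,10)], [(11,12),(55,10),(13,10)], [(15,11),(18,9)], [(18,10),(20,10)],
    [(13,10),(9,10),(27,9)], [(26,8),(13,8),(27,9)], [(26,11),(24,7),(13,7)],
    [(29,12),(14,10),(21,10)], [(35,9)], [(28,12),(9,6),(21,6)], [(23,12),(12,11),(33,11)],
    [(22,12),(34,11)], [(26,10),(27,10),(31,11)], [(15,11),(25,9),(25,9)], [(22,10),(14,10)],
    [(16,10),(9,10),(30,9)], [(27,8),(15,8),(30,9)], [(13,7),(24,7),(31,10)],
    [(13,12),(10,12),(9,6)], [(16,12),(15,11)], [(29,11),(11,11)], [(23,12),(12,10),(36,10)],
    [(12,13),(18,9)], [(31,11),(29,9),(29,9)], [(13,10),(50,10),(12,11)],
    [(27,9),(25,9),(24,9),(48,10)], [(13,10),(25,8),(27,10)], [(21,7),(14,7),(27,10)],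
    [(22,10),(20,6),(9,6)], [(37,12),(18,9)], [(30,12),(18,5)], [(8,4),(8,4),(29,11)],
    [(6,3),(13,12)], [(4,2),(11,11)], [(9,13),(1,1)], [(11,13),(11,12)], [(13,13),(15,12)],
    [(14,13),(17,12)], [(13,13),(21,12)], [(13,13),(20,12)], [(11,13),(21,12)], [(18,12),(34,11)],
    [(18,12),(33,11)], [(29,11),(15,11)], [(30,11),(14,10),(27,10)], [(16,10),(14,10),(45,10)],
    [(30,9),(27,9),(54,10)], [(23,8),(26,8),(26,9)], [(9,7),(25,7),(22,12)], [(11,13),(12,6)],
    [(14,12),(13,12)], [(11,13),(23,11)]]"

definition profile7 :: "rating list list" where
  "profile7 =
   [[(19,12),(36,10)], [(29,9),(30,9),(31,11)], [(27,10),(22,8),(23,8)], [(15,11),(28,9),(22,9)],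
    [(29,11),(17,8),(23,8)], [(17,10),(25,7)], [(34,9),(8,9)], [(31,12),(25,8),(27,8)],
    [(25,12),(24,7),(13,7)], [(26,11),(35,11)], [(19,12),(13,6)], [(32,11),(15,11)],
    [(28,11),(25,10),(26,10)], [(19,10),(25,12),(26,10)], [(23,12),(24,9)],
    [(13,8),(27,8),(20,11)], [(32,10),(13,7),(21,7)], [(27,9),(27,9),(25,11)],
    [(22,10),(27,8),(17,8)], [(29,9),(26,9)], [(29,11),(17,8),(25,8)], [(56,10),(17,10)],
    [(29,10),(13,10),(21,7)], [(8,11),(10,9),(13,9)], [(14,10),(19,8)], [(35,9)], [(23,6),(28,11)],
    [(17,5),(9,5),(30,10)], [(8,4),(8,4),(27,11)], [(13,11),(6,3)], [(18,13),(13,10)],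
    [(21,12),(12,9)], [(11,13),(4,2)], [(1,1),(9,12)], [(3,0)], [(11,13),(11,11)],
    [(13,12),(15,12)], [(13,13),(18,11)], [(13,12),(20,12)], [(11,13),(22,11)], [(19,12),(36,10)],
    [(30,9),(30,9),(30,11)], [(27,10),(22,8),(24,8)], [(15,11),(29,9),(21,9)], [(20,10),(16,10)],
    [(18,9),(21,10)], [(16,11),(16,8),(13,8)], [(29,10),(10,10)], [(17,9),(8,9)], [(14,12),(29,8)],
    [(32,11),(13,7),(25,7)], [(29,11),(25,10),(25,10)], [(20,10),(24,12),(27,10)],
    [(21,11),(13,12),(25,11)], [(32,11),(29,10)], [(15,11),(26,9),(25,9)], [(26,11),(16,8),(23,8)],
    [(17,10),(47,10)], [(30,9),(30,9),(56,10)], [(53,10),(28,9),(30,9),(26,9)]]"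

definition profile8 :: "rating list list" where
  "profile8 =
   [[(25,9),(25,9),(28,9),(52,10)], [(20,13),(22,8),(20,8)], [(33,12),(17,12)],
    [(25,12),(25,11),(31,11)], [(21,11),(13,12),(27,11)], [(10,10),(18,11),(25,10)],
    [(15,12),(28,10)], [(13,9),(26,9),(30,11)], [(28,11),(14,8),(23,8)], [(26,10),(20,10),(24,11)],
    [(14,12),(32,9),(18,11)], [(32,9),(18,10)], [(25,8),(26,8),(27,9)], [(25,7),(11,7),(29,8)],
    [(21,6),(10,11),(31,11)], [(27,11),(16,5),(8,11)], [(27,12),(26,10),(13,12)],
    [(16,12),(26,11),(24,11)], [(28,11),(14,10),(21,10)], [(34,9),(17,9)], [(31,9),(25,8),(27,8)],
    [(15,8),(27,8),(33,11)], [(15,11),(23,7)], [(31,10),(5,13)], [(17,12),(32,9),(28,9)],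
    [(29,11),(23,8),(27,8)], [(23,12),(10,7),(22,7)], [(13,13),(13,6)], [(10,5),(21,12)],
    [(17,12),(8,4)], [(15,12),(28,11)], [(19,12),(19,11)], [(17,10),(29,10)],
    [(30,9),(19,10),(21,10)], [(32,12),(26,8),(16,8)], [(25,7),(15,11)], [(10,10),(22,6),(29,10)],
    [(17,5),(9,5),(29,10)], [(26,11),(8,4),(8,4)], [(23,12),(15,10),(27,10)], [(28,11),(29,11)],
    [(18,10),(25,10),(29,11)], [(15,11),(31,9)], [(16,10),(20,10)], [(14,9),(26,9)],
    [(5,12),(30,9),(13,10)], [(13,11)], [(15,10),(17,10)], [(28,8),(15,8),(31,9)],
    [(13,7),(23,7),(32,10)], [(27,9),(9,6),(19,6)], [(27,12),(14,8),(24,8)],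
    [(24,12),(19,11),(25,11)], [(13,10),(47,10)], [(17,13),(17,7)], [(33,12),(10,12)],
    [(14,11),(12,11)], [(9,11),(20,10)], [(14,10),(9,10),(27,9)], [(20,8),(26,8),(19,10)]]"

definition profile9 :: "rating list list" where
  "profile9 =
   [[(25,7),(10,7),(29,8)], [(32,12),(10,14),(21,6)], [(30,12),(30,11),(18,12)],
    [(28,11),(17,12),(28,11)], [(19,10),(25,11),(27,10)], [(12,12),(21,10),(27,10)],
    [(13,11),(18,11)], [(24,11),(17,9),(27,9)], [(58,10)], [(14,11),(27,8)], [(18,10),(17,11)],
    [(18,8),(27,8),(21,10)], [(26,7),(18,9)], [(28,10),(25,7),(13,7)], [(28,11),(17,12),(23,9)],
    [(15,10),(55,10)], [(52,10),(28,9),(29,9),(26,9)], [(49,10),(28,9),(27,9),(23,9)],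
    [(47,11),(22,9),(29,9),(25,9)], [(24,11),(26,10),(23,10),(41,10)], [(27,11),(31,9)],
    [(23,8),(27,8),(26,10)], [(8,7),(24,7),(25,9)], [(29,11),(21,6),(10,12)],
    [(18,10),(27,10),(26,11)], [(15,11),(30,9)], [(19,10),(17,10)], [(13,12),(28,9),(5,12)],
    [(28,11),(13,8),(27,8)], [(20,10),(24,11),(27,10)], [(12,12),(22,10),(25,10)],
    [(17,12),(10,9),(26,9)], [(31,11),(31,9)], [(18,9),(32,9),(16,12)], [(29,8),(15,11)],
    [(24,7),(14,7),(33,10)], [(9,6),(21,6),(28,10)], [(27,10),(8,10),(16,5)],
    [(14,9),(26,9),(27,12)], [(17,13),(18,8)], [(19,12),(25,7)], [(15,11),(32,11)],
    [(13,11),(14,11),(52,10)], [(14,10),(18,10)], [(18,11),(17,9)], [(14,10),(17,8),(12,8)],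
    [(18,10),(16,10)], [(14,12),(15,9),(17,9)], [(23,9),(25,9),(30,9),(50,10)], [(29,8),(29,11)],
    [(25,11),(30,10),(16,11)], [(13,10),(18,11),(30,10)], [(25,9),(32,9),(17,12)],
    [(32,11),(29,8)], [(27,8),(22,8),(30,9)], [(28,10),(24,7),(13,7)], [(27,11),(17,9),(25,9)],
    [(15,10),(52,10)], [(29,9),(30,9),(23,10),(44,10)], [(13,8),(29,8),(29,11)]]"

definition profile10 :: "rating list list" where
  "profile10 =
   [[(11,14),(13,7),(9,7)], [(17,13),(11,13)], [(23,12),(19,12)], [(17,12),(10,12)],
    [(12,11),(12,12),(18,11)], [(13,6),(19,9)], [(16,12),(18,5)], [(19,11),(19,11)],
    [(31,10),(16,10)], [(24,12),(26,9),(27,9)], [(32,12),(13,8),(18,8)], [(24,12),(24,11),(31,11)],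
    [(16,13),(16,7)], [(18,12),(22,6)], [(8,5),(17,5),(29,11)], [(13,10),(8,4)], [(15,12),(6,3)],
    [(30,11),(8,11)], [(28,12),(15,10),(30,10)], [(13,12),(24,11),(33,11)], [(23,12),(36,10)],
    [(12,12),(25,11),(20,11)], [(19,12),(12,10),(31,10)], [(15,11),(16,10),(19,10)],
    [(19,10),(19,9)], [(17,9),(15,8),(15,8)], [(15,11),(28,8)], [(13,7),(24,7),(32,10)],
    [(21,6),(9,6),(29,9)], [(13,13),(10,5)], [(25,8),(14,8),(31,11)], [(12,7),(22,7),(27,12)],
    [(17,13),(13,6)], [(23,12),(19,12)], [(21,6),(8,11),(24,11)], [(27,11),(17,5),(8,5)],
    [(31,12),(22,10),(12,10)], [(27,12),(8,4),(8,4)], [(25,12),(14,11),(27,11)], [(28,12),(33,11)],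
    [(24,12),(12,11),(31,11)], [(12,11),(19,12),(28,11)], [(21,12),(26,11)], [(31,10),(32,10)],
    [(26,10),(26,9),(25,9)], [(16,13),(14,10)], [(27,11),(25,10),(26,10)],
    [(13,10),(43,10),(9,11)], [(27,9),(27,9),(51,10)], [(23,10)], [(17,12),(29,9),(16,10)],
    [(27,11),(15,11)], [(21,11),(13,10),(33,10)], [(29,9),(24,9),(27,10)], [(26,10),(24,8),(23,8)],
    [(15,11),(29,9),(19,11)], [(30,11),(17,8),(25,8)], [(26,11),(13,7),(21,7)],
    [(14,11),(9,6),(10,11)], [(6,13),(20,10)]]"

definition profile11 :: "rating list list" where
  "profile11 =
   [[(7,12),(8,12)], [(19,11)], [(19,12),(30,9)], [(15,11),(31,11)], [(32,11),(16,11),(29,10)],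
    [(49,10),(16,10),(13,10)], [(44,11),(22,9),(29,9),(26,9)], [(28,11),(30,10),(49,10)],
    [(24,9),(25,9),(30,9),(44,10)], [(17,8),(25,8),(18,10)], [(8,7),(23,7),(12,9)],
    [(23,6),(32,11)], [(17,5),(9,5),(31,10)], [(14,13),(8,4)], [(6,3),(15,12)], [(11,12),(4,2)],
    [(15,12),(13,11)], [(8,12),(29,11)], [(29,10),(15,10),(29,11)], [(31,11),(25,9),(14,9)],
    [(18,12),(32,10),(28,10)], [(29,11),(15,11)], [(15,11),(21,10)], [(14,11),(29,9),(7,11)],
    [(25,10),(24,8),(23,8)], [(17,12),(14,9),(31,9)], [(22,8),(27,8),(27,11)], [(29,11),(25,7)],
    [(12,12),(21,7),(32,10)], [(22,6),(30,9)], [(8,5),(17,5),(29,11)], [(13,13),(8,4)],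
    [(15,12),(6,3)], [(8,11),(29,11)], [(20,10)], [(31,10),(14,11),(27,11)],
    [(14,9),(30,9),(32,12)], [(27,8),(14,8),(34,11)], [(31,11),(23,7),(12,11)],
    [(26,12),(25,10),(26,10)], [(13,12),(43,11),(9,11)], [(30,10),(29,10),(46,10)],
    [(16,12),(28,9),(17,12)], [(28,11),(12,11)], [(23,12),(24,8),(22,8)], [(27,11),(31,11)],
    [(24,12),(10,7),(24,7)], [(29,11),(10,11),(19,6)], [(28,10),(29,10),(15,11)],
    [(31,9),(18,10),(22,10)], [(14,9),(31,9)], [(26,8),(23,8),(28,11)], [(25,7),(31,10)],
    [(22,6),(10,9),(31,9)], [(8,5),(17,5),(28,12)], [(33,12),(14,8),(29,8)],
    [(26,12),(26,11),(31,11)], [(25,11),(24,12),(15,11)], [(20,11),(14,11),(24,11)],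
    [(17,12),(30,10),(16,12)]]"

definition profile12 :: "rating list list" where
  "profile12 =
   [[(25,12),(20,9),(30,9)], [(22,12),(27,8)], [(11,7),(24,7),(31,11)], [(30,11),(27,8),(16,8)],
    [(13,11),(15,10),(45,10)], [(17,10),(19,9)], [(13,9),(29,9)], [(26,9),(27,9),(23,10),(34,11)],
    [(12,8),(28,8),(23,10)], [(23,7),(14,7),(32,10)], [(26,10),(20,6),(9,6)],
    [(32,12),(8,9),(25,9)], [(28,11),(23,12),(27,11)], [(56,10),(12,11)],
    [(27,9),(29,9),(28,9),(53,10)], [(23,8),(23,8),(25,9)], [(24,9),(23,7),(9,9)],
    [(19,12),(28,8),(12,12)], [(17,12),(16,11),(15,11)], [(18,10),(20,10)],
    [(32,12),(13,7),(24,7)], [(29,11),(24,12),(27,11)], [(14,12),(21,11),(24,11)],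
    [(21,10),(31,10)], [(20,13),(13,6)], [(28,12),(20,12)], [(15,12),(18,5)],
    [(27,12),(20,6),(10,12)], [(25,12),(9,5),(15,12)], [(7,12),(29,11)], [(23,7),(10,8),(25,8)],
    [(27,12),(10,14),(19,6)], [(25,12),(26,11),(15,11)], [(14,12),(24,10)], [(31,9),(27,9)],
    [(33,10),(18,8),(13,8)], [(31,9),(32,9),(19,10)], [(32,11),(16,8),(27,8)], [(16,10),(24,7)],
    [(8,9),(31,9)], [(19,8)], [(21,6),(10,9),(29,9)], [(29,8),(12,11),(30,11)],
    [(12,7),(25,7),(33,12)], [(23,7),(14,7),(31,10)], [(26,11),(21,6),(9,6)],
    [(20,12),(11,14),(32,10)], [(29,11),(20,11)], [(27,10),(9,5),(15,12)], [(13,9),(29,9),(24,11)],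
    [(31,10),(29,10)], [(8,4),(14,9)], [(15,13),(6,3)], [(29,12),(8,12)],
    [(27,12),(14,11),(29,11)], [(14,11),(24,12),(29,11)], [(28,12),(30,11)], [(20,13),(15,10)],
    [(29,11),(30,10),(13,12)], [(25,9),(12,9),(36,10)]]"

definition profile13 :: "rating list list" where
  "profile13 =
   [[(14,8),(28,8),(20,11)], [(23,7),(12,10),(33,10)], [(29,9),(26,9),(26,12)],
    [(26,12),(26,8),(20,8)], [(9,7),(21,7),(20,12)], [(23,6),(29,11)], [(15,8),(22,8),(27,11)],
    [(24,7),(31,10)], [(31,11),(28,9),(30,9)], [(11,12),(51,10),(13,10)],
    [(44,11),(28,9),(29,9),(23,11)], [(28,11),(29,10),(51,10)], [(23,11),(30,9),(30,9),(43,10)],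
    [(27,11),(29,10)], [(26,9),(25,8),(24,8)], [(17,8),(13,8),(33,9)], [(15,11),(13,7),(13,7)],
    [(25,8),(26,8),(31,11)], [(27,12),(13,7),(21,7)], [(24,11),(16,11),(26,11)], [(19,11),(13,6)],
    [(14,11),(9,5),(8,5)], [(9,6),(19,6),(24,11)], [(10,5),(13,12)], [(8,4),(18,11)],
    [(16,12),(30,10)], [(14,9),(28,9),(32,11)], [(31,11),(14,8),(24,8)], [(25,12),(25,10),(27,10)],
    [(50,11),(12,11)], [(23,11),(24,10),(23,10),(51,10)], [(19,10),(20,9),(21,10)],
    [(34,9),(17,12)], [(27,8),(27,8),(30,11)], [(29,11),(13,7),(24,7)], [(28,11),(16,11),(28,10)],
    [(17,10),(52,10)], [(21,9),(33,9),(16,10)], [(23,10),(17,8),(12,8)], [(31,9),(26,9)],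
    [(16,12),(13,7),(13,7)], [(29,9),(25,8),(26,8)], [(27,8),(10,8),(24,7)],
    [(19,6),(10,11),(30,11)], [(8,5),(15,12),(23,12)], [(7,11),(29,11)], [(18,12),(31,10),(25,10)],
    [(26,12),(20,13),(30,9)], [(25,11),(24,12),(15,11)], [(27,11),(32,11)],
    [(30,11),(28,8),(15,8)], [(14,11),(14,11),(46,10)], [(21,9),(22,9),(28,9),(42,10)],
    [(24,10),(29,8)], [(14,10),(22,8),(18,8)], [(26,8),(15,9),(29,9)], [(30,11),(21,7),(13,7)],
    [(24,12),(25,10),(26,10)], [(17,12),(14,9),(31,9)], [(24,8),(27,8),(27,11)]]"

definition profile14 :: "rating list list" where
  "profile14 =
   [[(24,11),(13,7),(21,7)], [(35,11),(24,10)], [(22,10),(21,6),(9,6)], [(35,10),(8,9),(12,9)],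
    [(31,8)], [(28,10),(9,5),(15,12)], [(26,11),(31,9),(13,9)], [(31,10),(33,10)],
    [(33,11),(17,9),(30,9)], [(13,11),(15,10),(53,10)], [(25,10),(26,8),(24,8)],
    [(30,12),(21,7),(13,7)], [(24,12),(9,6),(19,6)], [(18,5),(28,11)], [(33,11),(22,10),(12,10)],
    [(31,11),(32,10),(18,10)], [(31,11),(17,10),(29,10)], [(44,10),(16,10),(16,10)],
    [(51,11),(28,9),(29,9)], [(23,11),(26,10),(25,10),(52,10)], [(21,11),(15,9),(27,9)],
    [(25,9),(30,9),(24,9),(49,10)], [(26,9),(25,8),(24,8)], [(32,9),(14,8),(17,8)],
    [(29,11),(27,8),(25,8)], [(11,12),(46,10),(13,12)], [(42,11),(22,9),(22,9),(27,9)],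
    [(23,11),(24,10),(23,10),(34,11)], [(28,11),(56,10)], [(26,11),(27,8)],
    [(30,10),(23,7),(13,7)], [(28,12),(17,9),(29,9)], [(43,11),(14,11),(13,11)],
    [(28,11),(30,10),(47,10)], [(29,9),(30,9),(57,10)], [(13,8),(27,8),(29,10)],
    [(15,10),(32,9),(25,9)], [(30,9),(23,8),(26,8)], [(27,10),(25,8),(23,8)],
    [(14,12),(27,9),(24,9)], [(28,11),(16,8),(23,8)], [(23,7),(33,10)], [(26,10),(22,6),(10,10)],
    [(32,12),(8,9),(25,9)], [(12,12),(30,8),(20,11)], [(25,7),(13,7),(35,10)],
    [(30,11),(21,6),(10,13)], [(27,12),(32,10),(16,12)], [(26,11),(23,9),(30,9)],
    [(27,12),(13,8),(17,8)], [(22,12),(22,11),(24,11)], [(26,10),(24,8),(24,8)],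
    [(15,11),(31,9),(18,11)], [(31,10),(13,10)], [(26,11),(13,7),(21,7)],
    [(29,11),(14,10),(21,10)], [(31,9),(20,12)], [(19,11),(13,6)], [(8,5),(9,5),(15,10)],
    [(17,13),(19,9)]]"

definition profile15 :: "rating list list" where
  "profile15 =
   [[(19,12),(28,8)], [(12,7),(24,7),(33,11)], [(31,11),(10,14),(19,6)], [(18,13),(6,13)],
    [(28,12),(18,12)], [(18,5),(29,12)], [(8,4),(8,4),(28,11)], [(13,13),(6,3)],
    [(27,10),(15,10),(27,11)], [(13,12),(26,11),(32,11)], [(16,12),(33,10),(28,11)],
    [(27,10),(25,9),(30,9)], [(17,9),(31,9),(18,10)], [(25,8),(23,8),(28,9)],
    [(28,12),(26,8),(14,12)], [(18,8),(14,8),(29,9)], [(13,7),(13,7),(18,12)], [(13,6),(19,11)],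
    [(15,11),(33,10)], [(29,9),(26,9),(25,10)], [(26,12),(27,8),(20,8)], [(25,7),(23,12)],
    [(10,12),(21,6),(32,11)], [(16,12),(28,9),(18,9)], [(24,12),(23,8),(24,8)], [(18,8),(17,7)],
    [(19,12),(22,6)], [(25,12),(26,8),(22,8)], [(30,12),(20,7),(12,12)], [(28,11),(17,12),(30,11)],
    [(28,12),(22,6)], [(31,11),(23,7)], [(26,10),(27,10),(29,11)], [(14,12),(26,9),(25,9)],
    [(25,11),(14,11),(25,8)], [(13,8),(18,8),(29,11)], [(16,12),(17,7)], [(20,11),(23,6)],
    [(33,10),(16,10)], [(13,7),(14,7),(18,10)], [(10,14),(10,6),(14,9)], [(10,5),(14,8)],
    [(18,13),(8,4)], [(29,12),(16,12)], [(21,13),(14,7)], [(33,12),(19,12)],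
    [(26,12),(26,11),(30,11)], [(17,12),(30,10),(16,10)], [(24,12),(21,9),(29,9)],
    [(19,12),(10,8),(23,8)], [(26,7),(30,11)], [(21,6),(10,11),(33,11)], [(8,5),(15,12),(27,11)],
    [(12,10),(29,10),(26,11)], [(35,10),(11,14),(25,9)], [(29,11),(27,9),(30,9)],
    [(26,12),(26,8),(15,8)], [(50,11),(14,11)], [(30,11),(20,7),(12,11)],
    [(23,12),(25,10),(27,10)]]"

definition profile16 :: "rating list list" where
  "profile16 =
   [[(26,10),(25,8),(23,8)], [(24,12),(13,7),(23,7)], [(29,11),(32,11)], [(24,9),(22,7),(9,7)],
    [(19,12),(28,8),(13,8)], [(32,12),(13,7),(23,7)], [(8,12),(22,6),(26,11)], [(33,10),(31,11)],
    [(25,12),(22,6),(8,12)], [(32,11),(29,11)], [(27,12),(9,5),(17,5)], [(27,11),(8,4),(8,4)],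
    [(28,10),(14,11),(23,11)], [(32,11),(25,10)], [(6,3),(13,10)], [(11,13),(4,2)],
    [(18,13),(14,9)], [(21,13),(14,8)], [(32,12),(19,12)], [(30,12),(30,11),(18,11)],
    [(14,8),(27,8),(20,11)], [(22,7),(13,7),(32,10)], [(29,9),(24,9),(25,12)], [(28,8),(32,11)],
    [(18,12),(32,10),(31,10)], [(26,9),(26,9),(26,10)], [(29,11),(17,9),(31,9)],
    [(14,11),(15,10),(43,10)], [(26,9),(29,9),(52,10)], [(27,10),(25,8),(12,8)],
    [(16,11),(32,9),(19,11)], [(28,11),(24,8),(27,8)], [(33,10),(13,10)], [(19,10),(33,9),(29,9)],
    [(13,11),(26,9),(7,11)], [(13,10),(5,13)], [(12,12)], [(18,11),(12,11)],
    [(31,11),(14,11),(27,8)], [(32,10),(13,7),(21,7)], [(27,10),(26,8),(23,8)],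
    [(13,7),(22,7),(29,10)], [(19,6),(10,6),(25,9)], [(33,12),(28,8)], [(26,12),(17,9),(29,9)],
    [(26,11),(27,8),(20,8)], [(16,8),(26,8),(28,11)], [(31,10),(21,7),(12,11)],
    [(27,10),(26,9),(24,9)], [(14,11),(56,10)], [(9,11),(5,12),(26,9)], [(13,12),(52,10),(9,11)],
    [(28,9),(25,9),(24,9),(50,10)], [(28,8),(30,9)], [(25,10),(26,8),(24,8)],
    [(9,7),(25,7),(25,9)], [(21,9),(29,9),(28,9),(44,10)], [(29,9),(30,9),(51,10)],
    [(21,13),(13,6)], [(21,13),(10,5)]]"

definition profile17 :: "rating list list" where
  "profile17 =
   [[(24,12),(30,10),(17,12)], [(25,11),(20,9),(29,9)], [(17,9),(30,9),(18,10)],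
    [(25,8),(23,8),(27,9)], [(22,7),(11,7),(24,8)], [(32,12),(22,6)], [(13,6),(14,7)],
    [(25,7),(33,12)], [(20,6),(10,14),(32,11)], [(26,11),(15,13),(8,5)], [(25,12),(26,10),(12,10)],
    [(29,12),(7,12)], [(30,10),(32,10),(15,11)], [(28,9),(25,9),(27,10)], [(25,9),(24,7),(9,9)],
    [(10,13),(20,6),(30,11)], [(15,13),(9,5),(25,10)], [(30,9),(32,12)], [(27,8),(14,8),(33,11)],
    [(31,11),(22,7),(12,7)], [(24,12),(31,10),(18,10)], [(26,11),(20,13),(30,9)],
    [(29,11),(17,8),(13,8)], [(24,12),(30,10),(19,10)], [(24,11),(21,9),(29,9)],
    [(26,9),(29,9),(30,9),(55,10)], [(28,10),(23,8),(13,8)], [(25,9),(23,8),(23,8)],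
    [(31,9),(13,8),(18,8)], [(26,12),(26,8),(24,8)], [(27,8),(15,9),(31,9)],
    [(32,10),(22,7),(13,7)], [(26,10),(25,9),(27,9)], [(51,10),(30,9),(26,10),(29,9)],
    [(46,10),(27,9),(26,10),(26,9)], [(25,9),(27,9),(22,9),(40,10)], [(23,9),(23,8),(20,8)],
    [(24,8),(11,7),(22,7)], [(11,7),(23,7),(26,11)], [(22,6),(8,11),(26,11)],
    [(21,10),(14,10),(28,11)], [(34,9)], [(43,11),(29,9),(26,9)], [(20,8),(25,8),(26,11)],
    [(13,7),(24,7),(25,10)], [(20,6),(10,6),(28,9)], [(32,11),(30,9)], [(23,9),(13,8),(22,8)],
    [(20,8),(23,8),(14,10)], [(12,11),(10,7),(11,7)], [(25,7),(29,10)],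
    [(26,9),(29,9),(24,9),(42,10)], [(46,10),(29,9),(29,9)], [(10,10),(32,9)],
    [(24,9),(32,9),(15,10)], [(27,8),(23,8),(30,9)], [(25,10),(26,9),(29,9)], [(7,11),(30,11)],
    [(31,10),(23,7),(13,7)], [(26,9),(10,6),(19,6)]]"

definition profile18 :: "rating list list" where
  "profile18 =
   [[(27,8),(12,11),(26,11)], [(8,5),(15,12),(23,11)], [(30,9),(30,9),(44,10)],
    [(23,9),(30,9),(30,9),(44,10)], [(26,9),(30,9),(53,10)], [(48,10),(25,9),(27,9),(28,9)],
    [(26,9),(24,10),(27,9),(42,10)], [(23,9),(25,9),(24,9),(32,12)], [(50,11),(28,11)],
    [(25,9),(15,8),(22,8)], [(20,10),(25,8),(17,8)], [(32,9),(17,9)], [(14,8),(11,7),(12,7)],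
    [(18,5),(30,10)], [(24,7),(11,7),(27,8)], [(26,9),(28,9),(52,10)], [(26,8),(25,8),(29,9)],
    [(29,9),(24,10),(30,9),(49,10)], [(42,10),(28,9),(29,9),(21,9)], [(46,10),(28,9),(29,9)],
    [(26,8),(15,8),(29,9)], [(13,8),(30,8),(20,11)], [(36,10),(12,10),(24,7)], [(30,10),(55,10)],
    [(13,7),(23,7),(32,10)], [(9,11),(53,10),(13,10)], [(12,11),(24,7),(34,11)],
    [(27,10),(27,10),(31,11)], [(16,7),(18,10)], [(10,12),(34,9)], [(12,10),(28,10),(30,11)],
    [(24,9),(12,9),(33,10)], [(30,11),(17,9),(31,9)], [(23,8),(27,8),(27,10)],
    [(26,12),(23,9),(29,9)], [(14,12),(27,8),(29,11)], [(27,9),(30,9),(53,10)],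
    [(48,10),(25,9),(29,9),(28,9)], [(21,9),(25,9),(28,9),(43,10)], [(30,9),(27,9),(49,10)],
    [(25,10),(23,8),(23,8)], [(25,9),(23,7),(8,7)], [(28,10),(23,8),(12,8)],
    [(16,11),(32,9),(22,9)], [(12,8),(18,8),(25,10)], [(32,9),(29,9)], [(32,11),(25,7)],
    [(29,9),(14,8),(17,8)], [(25,8),(23,8),(25,11)], [(24,7),(33,10)], [(15,11),(21,10)],
    [(15,10),(30,9),(7,11)], [(24,9),(25,8),(22,8)], [(32,10),(31,10),(18,11)],
    [(29,11),(33,10),(18,10)], [(30,9),(25,9),(27,10)], [(31,11),(29,9),(14,11)],
    [(15,11),(32,10),(29,10)], [(16,8),(22,8),(28,11)], [(23,7),(13,7),(33,10)]]"

definition profile19 :: "rating list list" where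
  "profile19 =
   [[(9,6),(20,6),(28,10)], [(24,9),(11,14),(32,10)], [(51,11),(29,9),(29,9)], [(25,7),(28,8)],
    [(44,11),(28,9),(29,9),(23,9)], [(28,11),(29,10),(50,10)], [(28,11),(13,8),(26,8)],
    [(23,12),(8,4),(8,4)], [(30,12),(28,11)], [(30,9),(22,8),(27,8)], [(29,9),(18,10),(20,10)],
    [(29,10),(8,10),(16,5)], [(30,11),(27,9),(14,11)], [(8,4),(8,4),(24,11)], [(29,12),(30,10)],
    [(16,10),(31,9),(18,9)], [(24,8),(25,8),(26,9)], [(45,10),(30,9),(26,9)],
    [(21,6),(10,6),(30,9)], [(8,11),(16,5),(28,11)], [(12,10),(28,10),(30,11)],
    [(16,10),(31,9),(18,9)], [(26,8),(23,8),(29,9)], [(14,9),(34,9)], [(27,9),(19,10),(14,10)],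
    [(5,13),(33,10)], [(22,6),(33,11)], [(31,11),(13,7),(23,7)], [(24,9),(36,10)],
    [(13,10),(51,10),(12,11)], [(47,11),(28,9),(29,9),(24,11)], [(24,11),(24,10),(25,10),(41,10)],
    [(21,9),(25,9),(24,9),(31,11)], [(29,10),(47,10)], [(25,10),(13,10),(19,7)], [(23,6),(25,10)],
    [(32,10),(18,8),(12,8)], [(26,9),(32,9),(20,10)], [(14,11),(29,9),(7,11)],
    [(9,6),(21,6),(30,10)], [(20,11),(29,11)], [(15,13),(13,10)], [(26,11),(15,10),(25,10)],
    [(20,12),(10,5)], [(48,10),(25,10),(30,9),(29,9)], [(45,11),(28,9),(22,9),(24,9)],
    [(30,10),(29,10),(52,10)], [(48,10),(24,9),(30,9),(26,9)], [(41,10),(25,10),(27,9),(26,9)],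
    [(27,9),(30,9),(45,10)], [(28,11),(15,10),(29,10)], [(16,10),(32,9),(18,11)],
    [(27,9),(29,9),(22,9),(42,10)], [(29,9),(30,9),(43,10)], [(27,10),(26,10),(27,11)],
    [(23,8),(23,8),(19,11)], [(27,8),(34,11)], [(27,10),(24,9),(29,9)],
    [(46,11),(28,9),(22,9),(26,9)], [(23,11),(26,10),(25,10),(40,10)]]"

definition profile20 :: "rating list list" where
  "profile20 =
   [[(26,9),(30,9),(43,10)], [(18,10),(31,10),(25,11)], [(27,10),(21,10),(29,9)],
    [(23,8),(27,8),(25,10)], [(7,11),(8,11)], [(31,11),(29,9),(30,9)],
    [(50,10),(30,9),(25,9),(26,9)], [(43,10),(24,9),(29,9),(27,9)], [(24,9),(25,9),(24,9),(33,11)],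
    [(30,10),(52,10)], [(27,9),(32,9),(20,10)], [(30,9),(21,10),(26,10)], [(27,9),(26,8),(23,8)],
    [(24,11),(30,9),(30,9),(50,10)], [(43,10),(25,9),(29,9),(26,9)],
    [(24,9),(22,9),(25,9),(36,10)], [(27,9),(27,9),(34,11)], [(29,10),(56,10)],
    [(31,11),(27,10),(27,10)], [(14,10),(31,10)], [(47,10),(28,9),(25,9),(26,9)],
    [(39,10),(25,9),(27,9),(23,9)], [(43,11),(28,9),(26,9)], [(25,7),(36,10)],
    [(31,11),(25,9),(13,9)], [(27,10),(33,10),(18,11)], [(26,9),(32,9),(19,10)],
    [(30,9),(23,8),(25,8)], [(28,11),(28,10)], [(12,6),(22,11)], [(25,9),(32,9),(16,10)],
    [(52,10),(28,9),(29,9),(26,9)], [(51,10),(24,9),(29,9),(24,9)], [(44,10),(28,9),(27,9),(26,9)],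
    [(36,10),(24,9),(25,9),(25,9)], [(24,11),(22,9),(22,9),(21,9)], [(58,10)]]"

definition profile :: "rating list list" where
  "profile = concat
    [profile1, profile2, profile3, profile4, profile5, profile6, profile7, profile8, profile9,
     profile10, profile11, profile12, profile13, profile14, profile15, profile16,
     profile17, profile18, profile19, profile20]"

section \<open>Evaluation of the walks and of the certificate\<close>

lemma walk_13: "walk origin [0, 1, 1, 0, 1, 0, 1, 0, 1, 0, 1, 0, 0] = Some origin"
  by code_simp

lemma walk_14: "walk origin [0, 0, 1, 0, 1, 0, 1, 0, 1, 0, 1, 0, 1, 0] = Some origin"
  by code_simp

text \<open>The initial state claims rank 0 and weight 3; this weight returns as the numerator of
  the final constant.\<close>

lemma certificate: "explore profile [(origin, 3, 0)] Empty"
  by code_simp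

section \<open>Soundness of the search\<close>

lemma replicate_True_eq:
  "replicate i True @ False # xs = replicate j True @ False # ys \<longleftrightarrow> i = j \<and> xs = ys"
proof (induction i arbitrary: j)
  case 0 then show ?case by (cases j) auto
next
  case (Suc i) then show ?case by (cases j) auto
qed

lemma bits_append_eq: "bits a @ xs = bits b @ ys \<longleftrightarrow> a = b \<and> xs = ys"
  by (cases a rule: bits.cases; cases b rule: bits.cases) (auto simp: replicate_True_eq)

lemma bits_neq_Nil: "bits a \<noteq> []"
  by (cases a rule: bits.cases) auto

lemma bits_neq_separator: "False # True # True # xs \<noteq> bits a @ ys"
  by (cases a rule: bits.cases) auto

lemma concat_bits_eq: "concat (map bits L) = concat (map bits L') \<Longrightarrow> L = L'"
proof (induction L arbitrary: L')
  case Nil then show ?case by (cases L') (auto simp: bits_neq_Nil)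
next
  case (Cons a L) then show ?case by (cases L') (auto simp: bits_neq_Nil bits_append_eq)
qed

lemma concat_bits_separator_eq:
  "concat (map bits L) @ False # True # True # xs = concat (map bits L') @ False # True # True # ys \<Longrightarrow>
     L = L' \<and> xs = ys"
proof (induction L arbitrary: L')
  case Nil then show ?case by (cases L') (auto simp: bits_neq_separator)
next
  case (Cons a L)
  then show ?case
    by (cases L') (auto simp: bits_append_eq bits_neq_separator[symmetric])
qed

lemma key_inj: "key (L, H, k) = key (L', H', k') \<Longrightarrow> L = L' \<and> H = H'"
  by (auto dest!: concat_bits_separator_eq concat_bits_eq)

lemma lookup_insert_trie:
  "lookup cs (insert_trie a bs T) = Some e \<Longrightarrow> cs = bs \<and> e = a \<or> lookup cs T = Some e"
  by (induction a bs T arbitrary: cs rule: insert_trie.induct)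
    (case_tac [!] cs; case_tac [!] "hd cs"; auto)+

definition entries :: "(nat \<times> rating) trie \<Rightarrow> (state \<times> rating) set" where
  "entries T = {(S, v). lookup (key S) T = Some (slack S, v)}"

lemma entries_insert_trie:
  "entries (insert_trie (slack S, v) (key S) T) \<subseteq> insert (S, v) (entries T)"
proof -
  have "S' = S" if "key S' = key S" "slack S' = slack S" for S'
    using that key_inj by (cases S; cases S') (auto simp: slack_def)
  then show ?thesis by (auto simp: entries_def dest!: lookup_insert_trie)
qed

definition supported :: "(state \<times> rating) set \<Rightarrow> state \<Rightarrow> rating \<Rightarrow> bool" where
  "supported V S v \<longleftrightarrow> (\<exists>c. check S v c \<and> set (zip (nexts S) c) \<subseteq> V)"

text \<open>V collects the states first visited in the rest of the run. They may rely on the states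
  recorded in T, whose own support is owed by the earlier part of the run. This accommodates cycles,
  since a state is recorded before its successors are explored; for the empty trie no debt remains
  and V is closed.\<close>

lemma explore_supported:
  "explore cs Q T \<Longrightarrow> \<exists>V. set Q \<subseteq> V \<union> entries T \<and> (\<forall>(S, v) \<in> V. supported (V \<union> entries T) S v)"
  "explore' x cs S v Q T \<Longrightarrow> x = lookup (key S) T \<Longrightarrow>
     \<exists>V. insert (S, v) (set Q) \<subseteq> V \<union> entries T \<and> (\<forall>(S, v) \<in> V. supported (V \<union> entries T) S v)"
  "guard b cs Q T \<Longrightarrow>
     b \<and> (\<exists>V. set Q \<subseteq> V \<union> entries T \<and> (\<forall>(S, v) \<in> V. supported (V \<union> entries T) S v))"
proof (induction cs Q T and x cs S v Q T and b cs Q T rule: explore_explore'_guard.induct)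
  case (1 cs T) then show ?case by (intro exI[of _ "{}"]) auto
next
  case (3 e cs S v Q T)
  have "guard (e = (slack S, v)) cs Q T" using 3(2) by simp
  from 3(1)[OF this] obtain V where V: "set Q \<subseteq> V \<union> entries T"
    "\<forall>(S, v) \<in> V. supported (V \<union> entries T) S v" and e: "e = (slack S, v)"
    by blast
  moreover have "(S, v) \<in> entries T" using 3 e by (auto simp: entries_def)
  ultimately show ?case by (intro exI[of _ V]) auto
next
  case (5 c cs S v Q T)
  let ?T = "insert_trie (slack S, v) (key S) T"
  obtain V where V: "set (zip (nexts S) c @ Q) \<subseteq> V \<union> entries ?T"
      "\<forall>(S, v) \<in> V. supported (V \<union> entries ?T) S v" and c: "check S v c"
    using 5 by auto
  \<comment> \<open>S now pays its debt: its successors stand at the front of the queue just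
    processed, so they lie in V or among the recorded states.\<close>
  define V' where "V' = insert (S, v) V"
  have sub: "V \<union> entries ?T \<subseteq> V' \<union> entries T"
    using entries_insert_trie[of S v T] by (auto simp: V'_def)
  then have "supported (V' \<union> entries T) S v"
    using V(1) c unfolding supported_def by (intro exI[of _ c]) auto
  moreover have "supported (V' \<union> entries T) S' v'" if "(S', v') \<in> V" for S' v'
  proof -
    have "supported (V \<union> entries ?T) S' v'" using V(2) that by auto
    then show ?thesis using sub unfolding supported_def by (blast intro: order_trans)
  qed
  ultimately have "\<forall>(S, v) \<in> V'. supported (V' \<union> entries T) S v" by (auto simp: V'_def)
  moreover have "insert (S, v) (set Q) \<subseteq> V' \<union> entries T"
    using V(1) sub by (auto simp: V'_def)
  ultimately show ?case by (intro exI[of _ V']) auto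
qed auto

lemma lookup_Empty: "lookup bs Empty = None"
  by (cases bs rule: list.exhaust; simp; metis (full_types) lookup.simps)

lemma certificate_supported:
  "\<exists>V. (origin, 3, 0) \<in> V \<and> (\<forall>S v. (S, v) \<in> V \<longrightarrow> supported V S v)"
proof -
  have "entries Empty = {}" by (simp add: entries_def lookup_Empty)
  with explore_supported(1)[OF certificate] obtain V where
    "(origin, 3, 0) \<in> V" "\<forall>(S, v) \<in> V. supported V S v" by auto
  then show ?thesis by blast
qed

section \<open>Growth along the states\<close>

lemma at_least_mono: "at_least S d K \<Longrightarrow> K' \<le> K \<Longrightarrow> at_least S d K'"
  unfolding at_least_def by (blast intro: order_trans)

lemma at_least_0: "K \<le> 0 \<Longrightarrow> at_least S d K"
  by (auto simp: at_least_def intro: order_trans[OF _ of_nat_0_le_iff])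

lemma sum_list_map_filter:
  "sum_list (map g (List.map_filter h xs)) = (\<Sum>x\<leftarrow>xs. case h x of None \<Rightarrow> 0 | Some y \<Rightarrow> g y)"
  by (induction xs) (auto simp: List.map_filter_simps split: option.splits)

lemma in_set_map_filter: "h x = Some y \<Longrightarrow> x \<in> set xs \<Longrightarrow> y \<in> set (List.map_filter h xs)"
  by (induction xs) (auto simp: List.map_filter_simps split: option.splits)

lemma at_least_nexts:
  fixes f :: "state \<Rightarrow> real"
  assumes "bounded S" "13 \<le> d" and f: "\<And>S'. S' \<in> set (nexts S) \<Longrightarrow> at_least S' d (f S')"
  shows "at_least S (Suc d) (sum_list (map f (nexts S)))"
proof -
  have "at_least S (Suc d) (\<Sum>i\<le>slack S. case link S i of None \<Rightarrow> 0 | Some S' \<Rightarrow> f (normal S'))"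
  proof (rule at_least_step[OF assms(1,2)])
    fix i S' assume "i \<le> slack S" "link S i = Some S'"
    then have "normal S' \<in> set (nexts S)"
      by (auto simp: nexts_def simp del: upt_Suc intro!: imageI in_set_map_filter[of _ i])
    from f[OF this] show "at_least S' d (f (normal S'))"
      by (auto simp: normal_def intro: at_least_reflect split: if_splits)
  qed
  also have "(\<Sum>i\<le>slack S. case link S i of None \<Rightarrow> 0 | Some S' \<Rightarrow> f (normal S')) =
      (\<Sum>i\<leftarrow>[0..<Suc (slack S)]. case link S i of None \<Rightarrow> 0 | Some S' \<Rightarrow> f (normal S'))"
    unfolding interv_sum_list_conv_sum_set_nat set_upt by (rule sum.cong) auto
  also have "\<dots> = sum_list (map f (nexts S))"
    unfolding nexts_def map_map by (subst sum_list_map_filter) (simp only: comp_def)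
  finally show ?thesis .
qed

lemma at_least_next:
  assumes "bounded S" "13 \<le> d" "S' \<in> set (nexts S)" "at_least S' d 1"
  shows "at_least S (Suc d) 1"
proof -
  define f where "f T = (if T = S' then 1 else 0 :: real)" for T
  have "at_least T d (f T)" for T using assms(4) by (simp add: f_def at_least_0)
  with assms have "at_least S (Suc d) (sum_list (map f (nexts S)))" by (intro at_least_nexts)
  moreover have "f S' \<le> sum_list (map f (nexts S))"
    by (rule member_le_sum_list) (use assms(3) in \<open>auto simp: f_def\<close>)
  then have "1 \<le> sum_list (map f (nexts S))" by (simp add: f_def)
  ultimately show ?thesis by (rule at_least_mono)
qed

lemma at_least_walk:
  "walk S is = Some S' \<Longrightarrow> 13 \<le> d \<Longrightarrow> at_least S' d 1 \<Longrightarrow> at_least S (d + length is) 1"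
proof (induction S "is" rule: walk.induct)
  case (2 S i "is")
  then have "bounded S" "i < length (nexts S)" "walk (nexts S ! i) is = Some S'"
    by (auto split: if_splits)
  then show ?case using 2 at_least_next[of S "d + length is" "nexts S ! i"] by simp
qed simp

section \<open>Completions at the initial state\<close>

lemma entry_origin: "entry Lo (fst origin) i = Some (if i = 6 then Start else Lo i)"
proof -
  have "i < 6 \<or> i = 6 \<or> 7 \<le> i" by linarith
  then show ?thesis by (auto simp: entry_def origin_def nth_append)
qed

text \<open>Alternating outwards from 6 and 7 gives the differences 1, 2, ..., 13 in increasing
  order.\<close>

definition zigzag :: "int list" where
  "zigzag = [6, 7, 5, 8, 4, 9, 3, 10, 2, 11, 1, 12, 0, 13]"

lemma at_least_origin_13: "at_least origin 13 1"
  unfolding at_least_def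
proof (intro allI impI)
  fix t s m
  assume "represents origin t s (13 + slack origin) m" and m: "mates m"
  then have r: "represents (fst origin, [], 0) t s 13 m"
    by (simp add: origin_def slack_def)
  define f where "f i = t + s * i" for i :: int
  have s: "s \<noteq> 0" using representsD(1)[OF r] by auto
  have f_inj: "f i = f j \<longleftrightarrow> i = j" for i j using s by (simp add: f_def)
  have f_neg: "f i \<noteq> -1" if "i \<in> {0..13}" for i
    using representsD(3)[OF r, of "nat i"] that by (simp add: f_def nat_le_iff)
  have mf: "m (f i) = Some (if i = 6 then -1 else f i)" if "i \<in> {0..13}" for i
    using representsD(4)[OF r, of "nat i"] that unfolding entry_origin by (auto simp: f_def)
  have dom: "z \<in> f ` {0..13}" if zm: "m z \<noteq> None" for z
  proof -
    have "\<exists>i\<le>13. z = t + s * int i" by (rule representsD(6)[OF r zm])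
    then obtain i where "i \<le> 13" "z = f (int i)" by (auto simp: f_def)
    then show ?thesis by auto
  qed
  have z: "set zigzag = {0..13}"
    by (rule set_eqI) (simp add: zigzag_def, presburger)
  have z': "distinct zigzag" by (simp add: zigzag_def)
  have bij: "bij_betw gap (steps zigzag) {1..13}"
  proof -
    have "inj_on gap (steps zigzag)" by (simp add: zigzag_def gap_def)
    moreover have "gap ` steps zigzag = {1..13}"
      by (rule set_eqI) (simp add: zigzag_def gap_def, presburger)
    ultimately show ?thesis by (simp add: bij_betw_def)
  qed
  define p where "p = -1 # map f zigzag"
  have steps_p: "steps p = insert (-1, f 6) (map_prod f f ` steps zigzag)"
  proof -
    have "map f zigzag = f 6 # map f (tl zigzag)" by (simp add: zigzag_def)
    then have "steps p = insert (-1, f 6) (steps (map f zigzag))" by (simp only: p_def steps_Cons_Cons)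
    then show ?thesis by (simp only: steps_map)
  qed
  have sub: "a \<in> {0..13} \<and> b \<in> {0..13} \<and> a \<noteq> b" if "(a, b) \<in> steps zigzag" for a b
    using steps_subset[OF that] steps_neq[OF z' that] z by simp
  have "real_steps m p = map_prod f f ` steps zigzag"
  proof -
    have "m (f a) \<noteq> Some (f b) \<and> m (f b) \<noteq> Some (f a)" if "(a, b) \<in> steps zigzag" for a b
      using sub[OF that] mf[of a] mf[of b] f_neg[of a] f_neg[of b] by (auto simp: f_inj)
    then show ?thesis using mf[of 6] by (auto simp: real_steps_def steps_p)
  qed
  moreover have "bij_betw gap (map_prod f f ` steps zigzag) {1..13}"
  proof -
    have "gap (map_prod f f e) = gap e" for e
    proof -
      have "\<bar>f a - f b\<bar> = \<bar>a - b\<bar>" for a b using representsD(1)[OF r] by (auto simp: f_def)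
      then show ?thesis by (cases e) (simp add: gap_def)
    qed
    then have "bij_betw (gap \<circ> map_prod f f) (steps zigzag) {1..13}"
      using bij by (simp add: comp_def)
    moreover have "bij_betw (map_prod f f) (steps zigzag) (map_prod f f ` steps zigzag)"
      by (auto simp: bij_betw_def inj_on_def f_inj)
    ultimately show ?thesis by (simp add: bij_betw_comp_iff)
  qed
  moreover have "set p = insert (-1) (dom m)"
    using dom mf by (force simp: p_def z)
  moreover have "distinct p"
  proof -
    have "-1 \<notin> f ` {0..13}" using f_neg by (metis imageE)
    then show ?thesis by (simp add: p_def distinct_map z z' inj_on_def f_inj)
  qed
  moreover have "(x, y) \<in> steps p" if xy: "m y = Some x" "x \<noteq> y" for x y
  proof -
    obtain i where "i \<in> {0..13}" "y = f i" using dom[of y] xy by auto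
    then show ?thesis using xy mf[of i] by (auto simp: steps_p split: if_splits)
  qed
  ultimately have "p \<in> completions m 13"
    by (auto simp: completions_def) (simp_all add: p_def)
  then have "0 < card (completions m 13)"
    using finite_completions card_gt_0_iff by blast
  then show "1 \<le> real (card (completions m 13))" by simp
qed

lemma at_least_origin_add:
  assumes "at_least origin d 1" "13 \<le> d"
  shows "at_least origin (d + 13) 1" "at_least origin (d + 14) 1"
  using at_least_walk[OF walk_13 assms(2,1)] at_least_walk[OF walk_14 assms(2,1)]
  by (simp_all add: eval_nat_numeral)

text \<open>Every number from 13 + 13 * 12 = 169 on has the form 13 + 13 a + 14 b.\<close>

lemma at_least_origin:
  assumes "169 \<le> d"
  shows "at_least origin d 1"
proof -
  have A: "at_least origin (d + 13 * a) 1" if "at_least origin d 1" "13 \<le> d" for d a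
  proof (induction a)
    case (Suc a)
    then show ?case using at_least_origin_add(1)[OF Suc] that by (simp add: ac_simps)
  qed (use that in simp)
  have B: "at_least origin (13 + 14 * b) 1" for b
  proof (induction b)
    case (Suc b)
    then show ?case using at_least_origin_add(2)[OF Suc] by (simp add: ac_simps)
  qed (use at_least_origin_13 in simp)
  define r q where "r = (d - 13) mod 13" and "q = (d - 13) div 13"
  have "12 \<le> q" using assms by (simp add: q_def)
  moreover have "r < 13" by (simp add: r_def)
  moreover have "d - 13 = 13 * q + r" by (simp add: q_def r_def)
  ultimately have "d = 13 + 14 * r + 13 * (q - r)" using assms by (simp add: algebra_simps)
  then show ?thesis using A[OF B[of r], of "q - r"] by simp
qed

text \<open>A successor occurring several times may come with different claimed values, while
  \<open>at_least_nexts\<close> wants a function of the state. The maximum of its claims is itself a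
  claim, hence valid, and it dominates each of them.\<close>

lemma at_least_nexts_list:
  assumes "bounded S" "13 \<le> d" and len: "length Ks = length (nexts S)"
    and Ks: "\<And>S' K. (S', K) \<in> set (zip (nexts S) Ks) \<Longrightarrow> at_least S' d K"
  shows "at_least S (Suc d) (sum_list Ks)"
proof -
  let ?M = "\<lambda>S'. {K. (S', K) \<in> set (zip (nexts S) Ks)}"
  define f where "f S' = Max (?M S')" for S'
  have fin: "finite (?M S')" for S'
    by (rule finite_subset[of _ "set Ks"]) (auto dest: set_zip_rightD)
  have in_M: "Ks ! i \<in> ?M (nexts S ! i)" if "i < length Ks" for i
    using that len by (auto simp: set_zip)
  have "at_least S' d (f S')" if "S' \<in> set (nexts S)" for S'
  proof -
    obtain i where "i < length Ks" "nexts S ! i = S'"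
      using \<open>S' \<in> set (nexts S)\<close> len by (auto simp: in_set_conv_nth)
    then have "?M S' \<noteq> {}" using in_M by blast
    then have "f S' \<in> ?M S'" unfolding f_def by (rule Max_in[OF fin])
    then show ?thesis using Ks by blast
  qed
  with assms(1,2) have "at_least S (Suc d) (sum_list (map f (nexts S)))" by (rule at_least_nexts)
  moreover have "sum_list Ks \<le> sum_list (map f (nexts S))"
    using len in_M fin by (intro sum_list_mono2) (auto simp: f_def)
  ultimately show ?thesis by (rule at_least_mono)
qed

section \<open>Growth on a closed set of rated states\<close>

locale certified =
  fixes V :: "(state \<times> rating) set"
  assumes supported: "(S, v) \<in> V \<Longrightarrow> supported V S v"
begin

text \<open>Moving to a successor of smaller rank spends one difference and lowers the rank by at
  least one, so at least 169 differences are left when the rank is 0 and the state is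
  \<open>origin\<close>.\<close>

lemma reachable:
  "(S, w, r) \<in> V \<Longrightarrow> 169 + nat r \<le> d \<Longrightarrow> at_least S d 1"
proof (induction "nat r" arbitrary: S w r d rule: less_induct)
  case less
  obtain c where c: "check S (w, r) c" "set (zip (nexts S) c) \<subseteq> V"
    using supported[OF less.prems(1)] by (auto simp: supported_def)
  show ?case
  proof (cases "r = 0")
    case True
    then show ?thesis using c less.prems at_least_origin by simp
  next
    case False
    then obtain i where i: "i < length c" "snd (c ! i) < r"
      using c by (auto simp: list_ex_iff in_set_conv_nth)
    define S' where "S' = nexts S ! i"
    obtain w' r' where ci: "c ! i = (w', r')" by (cases "c ! i")
    have S': "S' \<in> set (nexts S)" using i c by (simp add: S'_def)
    have in_V: "(S', w', r') \<in> V"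
      using c i ci by (force simp: set_zip S'_def)
    have r': "0 \<le> r'" using supported[OF in_V] by (auto simp: supported_def)
    obtain d' where d': "d = Suc d'" using less.prems by (cases d) auto
    have "at_least S' d' 1"
      using less.hyps[OF _ in_V] i ci r' less.prems d' by simp
    then show ?thesis
      using at_least_next[of S d' S'] S' c d' less.prems by simp
  qed
qed

text \<open>At d = 189 = 169 + 20 every state has a completion, since all ranks are at most 20.\<close>

lemma growth:
  assumes "189 \<le> d" "(S, w, r) \<in> V"
  shows "at_least S d (2.37 ^ (d - 189) / 100 * real_of_int w)"
  using assms
proof (induction d arbitrary: S w r rule: dec_induct)
  case base
  obtain c where c: "check S (w, r) c" using supported[OF base] by (auto simp: supported_def)
  have "nat r \<le> 20" using c by (simp add: nat_le_iff)
  then have "at_least S 189 1" using reachable[OF base] by simp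
  \<comment> \<open>The power is 1 here, and \<open>check\<close> guarantees
    \<open>w \<le> 100\<close>.\<close>
  then show ?case by (rule at_least_mono) (use c in simp)
next
  case (step d)
  obtain c where c: "check S (w, r) c" "set (zip (nexts S) c) \<subseteq> V"
    using supported[OF step.prems] by (auto simp: supported_def)
  define K :: real where "K = 2.37 ^ (d - 189) / 100"
  define Ks where "Ks = map (\<lambda>v. K * real_of_int (fst v)) c"
  have "at_least S (Suc d) (sum_list Ks)"
  proof (rule at_least_nexts_list)
    show "at_least S' d k" if k: "(S', k) \<in> set (zip (nexts S) Ks)" for S' k
    proof -
      from k obtain v where "k = K * real_of_int (fst v)" "(S', v) \<in> set (zip (nexts S) c)"
        by (auto simp: Ks_def zip_map2)
      then obtain w' r' where "k = K * real_of_int w'" "(S', w', r') \<in> V"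
        using c(2) by (cases v) auto
      then show ?thesis using step.IH[of S' w' r'] unfolding K_def by metis
    qed
  qed (use c step.hyps in \<open>auto simp: Ks_def\<close>)
  moreover have "2.37 ^ (Suc d - 189) / 100 * real_of_int w \<le> sum_list Ks"
  proof -
    define W where "W = sum_list (map fst c)"
    have W: "237 * w \<le> 100 * W" using c by (simp add: W_def)
    have "sum_list (map (\<lambda>v. K * real_of_int (fst v)) xs) = K * real_of_int (sum_list (map fst xs))"
      for xs :: "rating list"
      by (induction xs) (simp_all add: algebra_simps)
    then have "sum_list Ks = K * real_of_int W" by (simp add: Ks_def W_def)
    moreover have "Suc d - 189 = Suc (d - 189)" using step.hyps by simp
    then have "2.37 ^ (Suc d - 189) / 100 * real_of_int w = K * (2.37 * real_of_int w)"
      by (simp add: K_def)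
    moreover have "2.37 * real_of_int w \<le> real_of_int W"
    proof -
      have "real_of_int (237 * w) \<le> real_of_int (100 * W)" using W by (simp only: of_int_le_iff)
      then show ?thesis by simp
    qed
    then have "K * (2.37 * real_of_int w) \<le> K * real_of_int W"
      by (rule mult_left_mono) (simp add: K_def)
    ultimately show ?thesis by (simp only:)
  qed
  ultimately show ?case by (rule at_least_mono)
qed

end

lemma at_least_origin_growth:
  assumes "189 \<le> d"
  shows "at_least origin d (2.37 ^ (d - 189) / 100 * 3)"
proof -
  obtain V where V: "(origin, 3, 0) \<in> V" "\<forall>S v. (S, v) \<in> V \<longrightarrow> supported V S v"
    using certificate_supported by blast
  interpret certified V using V(2) by unfold_locales blast
  show ?thesis using growth[OF assms V(1)] by simp
qed

section \<open>Graceful permutations\<close>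

text \<open>If every label is untouched except that 6 hangs on the start, the only fragment is the
  step from -1 to 6. Deleting the leading -1 from a completion leaves a graceful permutation of the
  \<open>Suc d\<close> labels. \<open>7 \<le> d\<close> leaves room for the seven entries of
  \<open>origin\<close>.\<close>

lemma num_graceful_ge:
  assumes K: "at_least origin d K" and d: "7 \<le> d"
  shows "K \<le> real (num_graceful (Suc d))"
proof -
  define m :: "int \<Rightarrow> int option" where
    "m z = (if 0 \<le> z \<and> z \<le> int d then Some (if z = 6 then -1 else z) else None)" for z
  have "represents (fst origin, [], 0) 0 1 d m"
    unfolding represents.simps entry_origin
  proof (intro conjI allI impI)
    show "length (fst origin) + length ([] :: row) \<le> d" using d by (simp add: origin_def)
    show "m (place 0 1 d (Hi i)) = map_option (place 0 1 d) (entry Hi [] i)"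
      if "i + length (fst origin) \<le> d" for i
      using that d by (auto simp: origin_def m_def entry_def)
    show "\<exists>i\<le>d. z = 0 + 1 * int i" if "m z \<noteq> None" for z
      using that by (intro exI[of _ "nat z"]) (auto simp: m_def split: if_splits)
  qed (auto simp: m_def)
  then have "represents origin 0 1 (d + slack origin) m"
    by (simp add: origin_def slack_def)
  moreover have "mates m" by (auto simp: mates_def m_def split: if_splits)
  ultimately have "K \<le> real (card (completions m d))" using K by (simp add: at_least_def)
  also have "card (completions m d) \<le> num_graceful (Suc d)"
    unfolding num_graceful_def
  proof (rule card_inj_on_le)
    \<comment> \<open>The index is moved by one to skip -1, and outside the range the identity is
      chosen, as \<open>permutes\<close> demands.\<close>
    define \<phi> where "\<phi> p i = (if i \<le> d then nat (p ! Suc i) else i)" for p :: "int list" and i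
    have dm: "dom m = {0..int d}" by (auto simp: m_def dom_def)
    have comp: "p = -1 # tl p \<and> length (tl p) = Suc d \<and> distinct (tl p) \<and> set (tl p) = {0..int d} \<and>
      bij_betw gap (steps (tl p)) {1..d}" if p: "p \<in> completions m d" for p
    proof -
      obtain q where q: "p = -1 # q" using p by (cases p) (auto simp: completions_def)
      have dq: "distinct q" "-1 \<notin> set q" and "insert (-1) (set q) = insert (-1) {0..int d}"
        using p by (simp_all add: completions_def q dm)
      then have sq: "set q = {0..int d}"
        using insert_ident[of "-1" "set q" "{0..int d}"] by simp
      have lq: "length q = Suc d" using distinct_card[OF dq(1)] by (simp add: sq)
      then obtain a q' where q': "q = a # q'" by (cases q) auto
      have "m 6 = Some (-1)" using d by (simp add: m_def)
      then have "(6, -1) \<in> steps p \<or> (-1, 6) \<in> steps p" using p by (auto simp: completions_def)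
      moreover have "-1 \<notin> set q" by (simp add: sq)
      \<comment> \<open>-1 occurs only at the head, so its step with 6 must be the first
        one.\<close>
      ultimately have a: "a = 6"
        using steps_subset[of 6 "-1" "q"] steps_subset[of "-1" 6 q] by (auto simp: q q')
      have "real_steps m p = steps q"
      proof -
        have "m x \<noteq> Some y \<and> m y \<noteq> Some x" if "(x, y) \<in> steps q" for x y
        proof -
          have "x \<in> set q" "y \<in> set q" using steps_subset[OF that] by auto
          moreover have "x \<noteq> y" using steps_neq[OF dq(1) that] .
          ultimately show ?thesis by (auto simp: m_def sq)
        qed
        moreover have "m a = Some (-1)" using a \<open>m 6 = Some (-1)\<close> by simp
        ultimately show ?thesis by (auto simp: real_steps_def q q')
      qed
      then show ?thesis using p dq sq lq by (simp add: q completions_def)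
    qed
    have nonneg: "0 \<le> tl p ! i \<and> p ! Suc i = tl p ! i" if "p \<in> completions m d" "i \<le> d" for p i
    proof -
      note c = comp[OF that(1)]
      then have "i < length (tl p)" using that(2) by simp
      then have "tl p ! i \<in> set (tl p)" by (rule nth_mem)
      then have "0 \<le> tl p ! i" using c by simp
      moreover have "p ! Suc i = tl p ! i" using c by (metis nth_Cons_Suc)
      ultimately show ?thesis by simp
    qed
    show "inj_on \<phi> (completions m d)"
    proof (rule inj_onI)
      fix p p' assume p: "p \<in> completions m d" "p' \<in> completions m d" and eq: "\<phi> p = \<phi> p'"
      have "tl p ! i = tl p' ! i" if "i \<le> d" for i
      proof -
        have "nat (p ! Suc i) = nat (p' ! Suc i)" using fun_cong[OF eq, of i] that by (simp add: \<phi>_def)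
        then show ?thesis using nonneg[OF p(1) that] nonneg[OF p(2) that] by linarith
      qed
      then have "tl p = tl p'" using comp p by (intro nth_equalityI) auto
      then show "p = p'" using comp p by metis
    qed
    show "\<phi> ` completions m d \<subseteq> {\<sigma>. graceful_permutation (Suc d) \<sigma>}"
    proof safe
      fix p assume "p \<in> completions m d"
      then obtain q where p: "p = -1 # q" and lq: "length q = Suc d" and dq: "distinct q"
        and sq: "set q = {0..int d}" and bij: "bij_betw gap (steps q) {1..d}"
        using comp[of p] by metis
      have phi: "\<phi> p i = nat (q ! i)" if "i \<le> d" for i using that by (simp add: \<phi>_def p)
      have qi: "q ! i \<in> {0..int d}" if "i \<le> d" for i
        using nth_mem[of i q] that lq sq by simp
      have "inj_on (\<phi> p) {0..<Suc d}"
      proof (rule inj_onI)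
        fix i j assume ij: "i \<in> {0..<Suc d}" "j \<in> {0..<Suc d}" "\<phi> p i = \<phi> p j"
        then have "q ! i = q ! j" using phi[of i] phi[of j] qi[of i] qi[of j] by auto
        then show "i = j" using ij dq lq by (simp add: nth_eq_iff_index_eq)
      qed
      moreover have "\<phi> p i < Suc d" if "i < Suc d" for i
        using phi[of i] qi[of i] that by auto
      then have "\<phi> p ` {0..<Suc d} \<subseteq> {0..<Suc d}" by auto
      ultimately have "bij_betw (\<phi> p) {0..<Suc d} {0..<Suc d}"
        by (simp add: bij_betw_def endo_inj_surj)
      then have perm: "\<phi> p permutes {0..<Suc d}"
        by (rule bij_imp_permutes) (simp add: \<phi>_def)
      have "{\<bar>int (\<phi> p (Suc i)) - int (\<phi> p i)\<bar> | i. Suc i < Suc d} = (\<lambda>e. int (gap e)) ` steps q"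
      proof -
        have "\<bar>int (\<phi> p (Suc i)) - int (\<phi> p i)\<bar> = int (gap (q ! i, q ! Suc i))" if "Suc i < Suc d" for i
          using phi[of i] phi[of "Suc i"] qi[of i] qi[of "Suc i"] that by (simp add: gap_def abs_minus_commute)
        then show ?thesis unfolding steps_nth lq image_def by (auto; metis)
      qed
      also have "\<dots> = int ` {1..d}"
        using bij by (metis bij_betw_imp_surj_on image_image)
      also have "\<dots> = {1..int (Suc d) - 1}" by (simp add: image_int_atLeastAtMost)
      finally show "graceful_permutation (Suc d) (\<phi> p)"
        using perm by (simp add: graceful_permutation_def)
    qed
    show "finite {\<sigma>. graceful_permutation (Suc d) \<sigma>}"
      by (rule finite_subset[OF _ finite_permutations[of "{0..<Suc d}"]]) (auto simp: graceful_permutation_def)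
  qed
  finally show ?thesis by simp
qed

theorem theorem1:
  "\<exists>c::real. c > 0 \<and> (\<exists>n\<^sub>0::nat. \<forall>n\<ge>n\<^sub>0. real (num_graceful n) \<ge> c * 2.37 ^ n)"
proof (intro exI conjI allI impI)
  \<comment> \<open>3 is the weight of \<open>origin\<close> and 100 the bound on the weights. The
    exponent is 190 and not 189 because n labels have d = n - 1 differences.\<close>
  show "(0::real) < 3 / (100 * 2.37 ^ 190)" by simp
  fix n :: nat assume n: "190 \<le> n"
  then obtain d where d: "n = Suc d" "189 \<le> d" by (cases n) auto
  have "3 / (100 * 2.37 ^ 190) * 2.37 ^ n = 3 * 2.37 ^ (d - 189) / (100 :: real)"
  proof -
    have "(2.37 :: real) ^ n = 2.37 ^ 190 * 2.37 ^ (d - 189)"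
      using d by (simp add: power_add[symmetric])
    then show ?thesis by simp
  qed
  also have "\<dots> \<le> real (num_graceful n)"
    using num_graceful_ge[OF at_least_origin_growth[OF d(2)]] d by simp
  finally show "3 / (100 * 2.37 ^ 190) * 2.37 ^ n \<le> real (num_graceful n)" .
qed

end
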